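(* Assume (A1)–(A7) (stated in the context) hold. Set $$\theta=1-\frac{\gamma_g\gamma_{h^*}}{2\|A\|_{\mathrm{op}}^2}\left(\sqrt{1+\frac{4\|A\|_{\mathrm{op}}^2}{\gamma_g\gamma_{h^*}}}-1\right),\qquad\tau=\frac{1-\theta}{\gamma_g\theta},\qquad\sigma=\frac{1-\theta}{\gamma_{h^*}\theta}.$$ Let $(x_0,y_0^* )\in\operatorname{dom}\partial g\times\operatorname{dom}\partial h^*$, let $y_{-1}^*=y_0^*$, and let $(x_s,y_s^* )$ be the unique saddle point of the Lagrangian $\mathcal L$. For $K\in\mathbb N$, consider the iterates generated for $k=0,1,2,\dots$ by $$x_{k+1}=\operatorname*{arg\,min}_{x\in\mathcal X}\Big\{g(x)+\langle y_k^*+\theta(y_k^*-y_{k-1}^* ),Ax\rangle+\tfrac1\tau D_{\phi_{\mathcal X}}(x,x_k)\Big\},$$ $$y_{k+1}^*=\operatorname*{arg\,max}_{y^*\in\mathcal Y^*}\Big\{-h^*(y^* )+\langle y^*,Ax_{k+1}\rangle-\tfrac1\sigma D_{\phi_{\mathcal Y^*}}(y^*,y_k^* )\Big\}.$$ Define $$T_K=\sum_{k=1}^K\frac1{\theta^{k-1}}=\frac{1-\theta^K}{(1-\theta)\theta^{K-1}},\quad X_K=\frac1{T_K}\sum_{k=1}^K\frac1{\theta^{k-1}}x_k,\quad Y_K^*=\frac1{T_K}\sum_{k=1}^K\frac1{\theta^{k-1}}y_k^*,$$ and, for $(x,y^* )\in\operatorname{dom}g\times\operatorname{dom}h^*$,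 $$\Delta_k(x,y^* )=\tfrac1\tau D_{\phi_{\mathcal X}}(x,x_k)+\tfrac1\sigma D_{\phi_{\mathcal Y^*}}(y^*,y_k^* )+\tfrac\theta\sigma D_{\phi_{\mathcal Y^*}}(y_k^*,y_{k-1}^* )+\theta\langle y_k^*-y_{k-1}^*,A(x-x_k)\rangle.$$ Then: (a) For every $(x,y^* )\in\operatorname{dom}g\times\operatorname{dom}h^*$ and every nonnegative integer $k$, $$\mathcal L(x_{k+1},y^* )-\mathcal L(x,y_{k+1}^* )\le\Delta_k(x,y^* )-\Delta_{k+1}(x,y^* )/\theta.$$ (b) For every $(x,y^* )\in\operatorname{dom}g\times\operatorname{dom}h^*$, $$T_K\big(\mathcal L(X_K,y^* )-\mathcal L(x,Y_K^* )\big)\le\Delta_0(x,y^* )-\frac1{\theta^K}\Delta_K(x,y^* ),$$ and for the saddle point, $$\tfrac1\sigma D_{\phi_{\mathcal Y^*}}(y_s^*,y_K^* )\le\Delta_K(x_s,y_s^* )\le\theta^K\Delta_0(x_s,y_s^* ).$$ (c) The sequences $\{(x_k,y_k^* )\}_{k=1}^{+\infty}$ and $\{(X_K,Y_K^* )\}_{K=1}^{+\infty}$ both converge strongly to the unique saddle point $(x_s,y_s^* )$ of $\mathcal L$.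
   Context: $\mathcal X,\mathcal Y$ are real reflexive Banach spaces with norms $\|\cdot\|_{\mathcal X},\|\cdot\|_{\mathcal Y}$, with duals $\mathcal X^*,\mathcal Y^*$ (dual norms $\|\cdot\|_{\mathcal X^*},\|\cdot\|_{\mathcal Y^*}$) and duality pairing $\langle\cdot,\cdot\rangle$. $A:\mathcal X\to\mathcal Y$ is a bounded linear operator with adjoint $A^*$, and $\|A\|_{\mathrm{op}}=\sup_{\|x\|_{\mathcal X}=1}\|Ax\|_{\mathcal Y}$. $\Gamma_0(\mathcal X)$ denotes the proper, convex, lower semicontinuous functions $\mathcal X\to\mathbb R\cup\{+\infty\}$ (similarly for other spaces). $h^*$ is the convex conjugate of $h$, $\partial$ the subdifferential, $\operatorname{dom}\partial f$ the set of points where $\partial f$ is nonempty. Lagrangian: $\mathcal L(x,y^* )=g(x)+\langle y^*,Ax\rangle-h^*(y^* )$. A saddle point of $\mathcal L$ is $(x_s,y_s^* )\in\mathcal X\times\mathcal Y^*$ with $\mathcal L(x_s,y^* )\le\mathcal L(x_s,y_s^* )\le\mathcal L(x,y_s^* )$ for all $x\in\mathcal X,y^*\in\mathcal Y^*$. Primal problem: $\inf_{x\in\mathcal X}\{g(x)+h(Ax)\}$. A function $f\in\Gamma_0(\mathcal X)$ is essentially smooth if $\operatorname{dom}\partial f\neq\varnothing$, $\operatorname{dom}\partial f=\operatorname{int}(\operatorname{dom}f)$, $f$ is differentiable on $\operatorname{int}(\operatorname{dom}f)$ (there is a continuous linear functional $\nabla f(x)$ giving all one-sided directional derivatives), and $\|\nabla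 f(x_k)\|_{\mathcal X^*}\to+\infty$ for every sequence $(x_k)$ in $\operatorname{int}(\operatorname{dom}f)$ converging to a boundary point of $\operatorname{dom}f$. It is essentially strictly convex if it is strictly convex on every convex subset of $\operatorname{dom}\partial f$ and $\partial f^*$ is locally bounded on its domain. A proper function $f$ is supercoercive if $f(x_k)/\|x_k\|\to+\infty$ whenever $\|x_k\|\to+\infty$. It is $m$-strongly convex if $f(\lambda x+(1-\lambda)x')\le\lambda f(x)+(1-\lambda)f(x')-\frac m2\lambda(1-\lambda)\|x-x'\|^2$ for all $x,x'\in\operatorname{dom}f$, $\lambda\in[0,1]$. These notions apply likewise on $\mathcal Y^*$. Bregman divergences (values in $[0,+\infty]$, second argument in the interior of the domain): $D_{\phi_{\mathcal X}}(x,\bar x)=\phi_{\mathcal X}(x)-\phi_{\mathcal X}(\bar x)-\langle\nabla\phi_{\mathcal X}(\bar x),x-\bar x\rangle$, $D_{\phi_{\mathcal Y^*}}(y^*,\bar y^* )=\phi_{\mathcal Y^*}(y^* )-\phi_{\mathcal Y^*}(\bar y^* )-\langle y^*-\bar y^*,\nabla\phi_{\mathcal Y^*}(\bar y^* )\rangle$. Assumptions. (A1) $g\in\Gamma_0(\mathcal X)$, $h\in\Gamma_0(\mathcal Y)$; the primal problem has at least one solution; and there is $x\in\operatorname{dom}g$ such that $Ax\in\operatorname{dom}h$ and $h$ is continuous at $Ax$. (A2) $\phi_{\mathcal X}\in\Gamma_0(\mathcal X)$ and $\phi_{\mathcal Y^*}\in\Gamma_0(\mathcal Y^* )$ are both essentially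 smooth and essentially strictly convex. (A3) $\operatorname{dom}\partial g\subseteq\operatorname{int}(\operatorname{dom}\phi_{\mathcal X})$, and at least one of $g,\phi_{\mathcal X}$ is supercoercive. (A4) $\operatorname{dom}\partial h^*\subseteq\operatorname{int}(\operatorname{dom}\phi_{\mathcal Y^*})$, and at least one of $h^*,\phi_{\mathcal Y^*}$ is supercoercive. (A5) $\phi_{\mathcal X}$ and $\phi_{\mathcal Y^*}$ are 1-strongly convex with respect to $\|\cdot\|_{\mathcal X}$ and $\|\cdot\|_{\mathcal Y^*}$, respectively, on their domains. (A6) There is $\gamma_g>0$ such that $x\mapsto g(x)-\gamma_g\phi_{\mathcal X}(x)$ is convex. (A7) There is $\gamma_{h^*}>0$ such that $y^*\mapsto h^*(y^* )-\gamma_{h^*}\phi_{\mathcal Y^*}(y^* )$ is convex. Under (A1)–(A4) the iterates are uniquely defined and lie in $\operatorname{dom}\partial g\times\operatorname{dom}\partial h^*$; under (A1), (A6), (A7) the Lagrangian has a unique saddle point. *)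

theory Defs
  imports "HOL-Analysis.Analysis"
begin

text \<open>
  The dual of a real normed space is the space of bounded linear functionals, whose norm
  as an operator is the dual norm. Functions with values in the reals extended by infinity have
  type \<^typ>\<open>ereal\<close>; that minus infinity is not a value is part of \<open>proper\<close>.
\<close>

type_synonym 'a dual = "'a \<Rightarrow>\<^sub>L real"

definition reflexive_space :: "'a::real_normed_vector itself \<Rightarrow> bool" where
  "reflexive_space _ \<longleftrightarrow> (\<forall>\<Phi> :: 'a dual dual. \<exists>x :: 'a. \<forall>\<xi>. blinfun_apply \<Phi> \<xi> = blinfun_apply \<xi> x)"

definition effdom :: "('a \<Rightarrow> ereal) \<Rightarrow> 'a set" where
  "effdom f = {x. f x < \<infinity>}"

definition proper :: "('a \<Rightarrow> ereal) \<Rightarrow> bool" where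
  "proper f \<longleftrightarrow> (\<forall>x. f x \<noteq> -\<infinity>) \<and> effdom f \<noteq> {}"

text \<open>
  The right-hand side below uses the conventions of \<^typ>\<open>ereal\<close>: zero times infinity is zero,
  and infinity plus minus infinity (in either order) is plus infinity. Hence the
  definition is also the usual one (convexity of the epigraph) for functions that take
  the value minus infinity.
\<close>

definition convex_fun :: "('a::real_vector \<Rightarrow> ereal) \<Rightarrow> bool" where
  "convex_fun f \<longleftrightarrow> (\<forall>x x'. \<forall>t\<in>{0..1::real}.
     f (t *\<^sub>R x + (1 - t) *\<^sub>R x') \<le> ereal t * f x + ereal (1 - t) * f x')"

definition lower_semicontinuous :: "('a::topological_space \<Rightarrow> ereal) \<Rightarrow> bool" where
  "lower_semicontinuous f \<longleftrightarrow> (\<forall>x. f x \<le> Liminf (at x) f)"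

definition \<Gamma>\<^sub>0 :: "('a::real_normed_vector \<Rightarrow> ereal) set" where
  "\<Gamma>\<^sub>0 = {f. proper f \<and> convex_fun f \<and> lower_semicontinuous f}"

definition conjugate :: "('a::real_normed_vector \<Rightarrow> ereal) \<Rightarrow> 'a dual \<Rightarrow> ereal" where
  "conjugate f \<xi> = (SUP x. ereal (blinfun_apply \<xi> x) - f x)"

definition subdiff :: "('a::real_normed_vector \<Rightarrow> ereal) \<Rightarrow> 'a \<Rightarrow> 'a dual set" where
  "subdiff f x = {\<xi>. \<bar>f x\<bar> \<noteq> \<infinity> \<and> (\<forall>z. f x + ereal (blinfun_apply \<xi> (z - x)) \<le> f z)}"

definition dom_subdiff :: "('a::real_normed_vector \<Rightarrow> ereal) \<Rightarrow> 'a set" where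
  "dom_subdiff f = {x. subdiff f x \<noteq> {}}"

definition has_gradient :: "('a::real_normed_vector \<Rightarrow> ereal) \<Rightarrow> 'a dual \<Rightarrow> 'a \<Rightarrow> bool" where
  "has_gradient f \<xi> x \<longleftrightarrow>
     (\<forall>d. ((\<lambda>t::real. (f (x + t *\<^sub>R d) - f x) / ereal t) \<longlongrightarrow> ereal (blinfun_apply \<xi> d)) (at_right 0))"

definition grad :: "('a::real_normed_vector \<Rightarrow> ereal) \<Rightarrow> 'a \<Rightarrow> 'a dual" where
  "grad f x = (THE \<xi>. has_gradient f \<xi> x)"

definition essentially_smooth :: "('a::real_normed_vector \<Rightarrow> ereal) \<Rightarrow> bool" where
  "essentially_smooth f \<longleftrightarrow>
     dom_subdiff f \<noteq> {} \<and>
     dom_subdiff f = interior (effdom f) \<and>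
     (\<forall>x\<in>interior (effdom f). \<exists>\<xi>. has_gradient f \<xi> x) \<and>
     (\<forall>X b. (\<forall>k::nat. X k \<in> interior (effdom f)) \<and> b \<in> frontier (effdom f) \<and> X \<longlonglongrightarrow> b \<longrightarrow>
        filterlim (\<lambda>k. norm (grad f (X k))) at_top sequentially)"

definition strictly_convex_fun_on :: "'a::real_vector set \<Rightarrow> ('a \<Rightarrow> ereal) \<Rightarrow> bool" where
  "strictly_convex_fun_on S f \<longleftrightarrow> (\<forall>x\<in>S. \<forall>x'\<in>S. \<forall>t\<in>{0<..<1::real}. x \<noteq> x' \<longrightarrow>
     f (t *\<^sub>R x + (1 - t) *\<^sub>R x') < ereal t * f x + ereal (1 - t) * f x')"

definition locally_bounded_on_domain :: "('a::topological_space \<Rightarrow> 'b::metric_space set) \<Rightarrow> bool" where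
  "locally_bounded_on_domain F \<longleftrightarrow>
     (\<forall>x. F x \<noteq> {} \<longrightarrow> (\<exists>U. open U \<and> x \<in> U \<and> bounded (\<Union>z\<in>U. F z)))"

text \<open>
  The subdifferential of the conjugate has values in the bidual. In a reflexive space
  this is the space itself, with the same norm.
\<close>

definition essentially_strictly_convex :: "('a::real_normed_vector \<Rightarrow> ereal) \<Rightarrow> bool" where
  "essentially_strictly_convex f \<longleftrightarrow>
     (\<forall>S. convex S \<and> S \<subseteq> dom_subdiff f \<longrightarrow> strictly_convex_fun_on S f) \<and>
     locally_bounded_on_domain (subdiff (conjugate f))"

definition supercoercive :: "('a::real_normed_vector \<Rightarrow> ereal) \<Rightarrow> bool" where
  "supercoercive f \<longleftrightarrow> (\<forall>X :: nat \<Rightarrow> 'a.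
     filterlim (\<lambda>k. norm (X k)) at_top sequentially \<longrightarrow>
     (\<lambda>k. f (X k) / ereal (norm (X k))) \<longlonglongrightarrow> \<infinity>)"

definition strongly_convex :: "real \<Rightarrow> ('a::real_normed_vector \<Rightarrow> ereal) \<Rightarrow> bool" where
  "strongly_convex m f \<longleftrightarrow> (\<forall>x\<in>effdom f. \<forall>x'\<in>effdom f. \<forall>t\<in>{0..1::real}.
     f (t *\<^sub>R x + (1 - t) *\<^sub>R x') \<le>
       ereal t * f x + ereal (1 - t) * f x' - ereal (m / 2 * t * (1 - t) * (norm (x - x'))\<^sup>2))"

text \<open>
  For a function on a dual space the gradient lies in the bidual; its value at \<open>y - y'\<close> is
  the pairing of \<open>y - y'\<close> with the point of the (reflexive) space that represents it.
\<close>

definition bregman :: "('a::real_normed_vector \<Rightarrow> ereal) \<Rightarrow> 'a \<Rightarrow> 'a \<Rightarrow> ereal" where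
  "bregman \<phi> x x' = \<phi> x - \<phi> x' - ereal (blinfun_apply (grad \<phi> x') (x - x'))"

text \<open>
  If both \<open>g x\<close> and \<open>conjugate h y\<close> are infinite, the difference is plus infinity. For
  proper \<open>g\<close> and \<open>conjugate h\<close> this has no influence on which points are saddle points: they
  lie in \<open>effdom g \<times> effdom (conjugate h)\<close> whichever value is chosen.
\<close>

definition lagrangian ::
  "('a::real_normed_vector \<Rightarrow> ereal) \<Rightarrow> ('b::real_normed_vector \<Rightarrow> ereal) \<Rightarrow> ('a \<Rightarrow>\<^sub>L 'b) \<Rightarrow>
     'a \<Rightarrow> 'b dual \<Rightarrow> ereal" where
  "lagrangian g h A x y = g x + ereal (blinfun_apply y (blinfun_apply A x)) - conjugate h y"

definition saddle_point :: "('a \<Rightarrow> 'b \<Rightarrow> ereal) \<Rightarrow> 'a \<Rightarrow> 'b \<Rightarrow> bool" where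
  "saddle_point L xs ys \<longleftrightarrow> (\<forall>x y. L xs y \<le> L xs ys \<and> L xs ys \<le> L x ys)"

text \<open>
  The term preceding \<open>y k\<close> in a sequence \<open>y\<close>, with the convention that the term of index
  minus one is \<open>y 0\<close>.
\<close>

fun previous :: "(nat \<Rightarrow> 'a) \<Rightarrow> nat \<Rightarrow> 'a" where
  "previous y 0 = y 0"
| "previous y (Suc k) = y k"

end

(*
  The relative convexity of g and h* with respect to the Bregman kernels replaces the subdifferential
  sum rule: writing g = psi + gamma phi with psi convex, a minimizer p of a Bregman proximal step
  stays in the interior of dom phi because the gradients of phi blow up at the boundary, and then
  comparing p with the points p + t (u - p) as t tends to 0 yields a three-point inequality with the
  gain gamma D(u, p). Adding the primal and the dual inequality gives (a), since theta is the
  root for which gamma_g + 1/tau = 1/(tau theta), gamma_h + 1/sigma = 1/(sigma theta) and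
  theta |A|^2 tau sigma = 1 hold simultaneously. Telescoping and Jensen's inequality give (b), and the
  geometric decay of Delta at the saddle point gives (c).
*)
theory Submission
  imports Defs
begin

text \<open>For every \<theta> in (0,1) the formulas for \<open>\<tau>\<close> and
  \<open>\<sigma>\<close> already turn the convexity gains into the factor 1/\<theta> on both
  weights. The value of \<theta> comes from the coupling alone: with c = \<gamma>g \<gamma>h / |A|^2
  it must solve (1 - \<theta>)^2 = c \<theta>, and it is the root below 1. This equality leaves no
  slack. Young's inequality with equal weights consumes the whole quadratic lower bound of the
  primal divergence, so \<Delta> directly controls only the dual distance. Hence x converges after
  y, by an unequal Young splitting whose cost is a multiple of |y_k - y_(k-1)|^2, which is then
  known to vanish. In a single step the obstacle is circular: differentiating the kernel at the
  minimizer requires an interior point, but interiority has to come from optimality. Optimality is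
  therefore first kept as a bound on finite difference quotients, used once to exclude the boundary
  and once more to pass to the limit.\<close>

abbreviation fin :: "('a \<Rightarrow> ereal) \<Rightarrow> 'a \<Rightarrow> real" where
  "fin f u \<equiv> real_of_ereal (f u)"

text \<open>\<open>fin\<close> sends infinite values to 0, so this is the divergence only between
  points of \<open>effdom \<phi>\<close>. All estimates are made with it in the reals and carried
  back by \<open>bregman_eq_breg\<close>.\<close>

definition breg :: "('a::real_normed_vector \<Rightarrow> ereal) \<Rightarrow> 'a \<Rightarrow> 'a \<Rightarrow> real" where
  "breg \<phi> u w = fin \<phi> u - fin \<phi> w - grad \<phi> w (u - w)"

section \<open>Finite values, conjugates and gradients\<close>

lemma effdomE:
  assumes "u \<in> effdom f" "f u \<noteq> -\<infinity>"
  obtains r where "f u = ereal r"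
  using assms by (cases "f u") (auto simp: effdom_def)

lemma breg_self [simp]: "breg \<phi> u u = 0"
  by (simp add: breg_def blinfun.zero_right)

lemma bregman_eq_breg:
  assumes "\<And>v. \<phi> v \<noteq> -\<infinity>" "u \<in> effdom \<phi>" "w \<in> effdom \<phi>"
  shows "bregman \<phi> u w = ereal (breg \<phi> u w)"
  unfolding bregman_def breg_def
  by (rule effdomE[OF assms(2,1)], rule effdomE[OF assms(3,1)]) simp

lemma convex_fun_imp_convex_on:
  assumes "convex_fun f" "\<And>u. f u \<noteq> -\<infinity>"
  shows "convex_on (effdom f) (fin f)"
proof -
  have *: "f ((1 - t) *\<^sub>R u + t *\<^sub>R v) \<le> ereal ((1 - t) * fin f u + t * fin f v)"
    if "u \<in> effdom f" "v \<in> effdom f" "0 \<le> t" "t \<le> 1" for u v t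
  proof -
    have "f ((1 - t) *\<^sub>R u + (1 - (1 - t)) *\<^sub>R v) \<le> ereal (1 - t) * f u + ereal (1 - (1 - t)) * f v"
      using that by (intro assms(1)[unfolded convex_fun_def, rule_format]) auto
    then show ?thesis
      by - (rule effdomE[OF that(1) assms(2)], rule effdomE[OF that(2) assms(2)], simp)
  qed
  have cv: "convex (effdom f)"
    unfolding convex_alt using * by (force simp: effdom_def)
  show ?thesis
  proof (rule convex_onI[OF _ cv])
    fix t :: real and u v assume h: "0 < t" "t < 1" "u \<in> effdom f" "v \<in> effdom f"
    let ?z = "(1 - t) *\<^sub>R u + t *\<^sub>R v"
    have "?z \<in> effdom f" using cv h unfolding convex_alt by simp
    then obtain r where "f ?z = ereal r" by (rule effdomE[of _ f, OF _ assms(2)])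
    with *[of u v t] h show "fin f ?z \<le> (1 - t) * fin f u + t * fin f v" by simp
  qed
qed

lemma conjugate_not_MInf:
  assumes "proper h"
  shows "conjugate h v \<noteq> -\<infinity>"
proof -
  obtain u where u: "u \<in> effdom h" using assms by (auto simp: proper_def)
  then obtain r where r: "h u = ereal r" using assms by (auto simp: proper_def elim: effdomE)
  have "ereal (v u) - h u \<le> conjugate h v"
    unfolding conjugate_def by (rule SUP_upper) simp
  then show ?thesis using r by auto
qed

lemma convex_fun_conjugate:
  assumes "proper h"
  shows "convex_fun (conjugate h)"
  unfolding convex_fun_def
proof (intro allI ballI)
  fix v w :: "'a dual" and t :: real assume t: "t \<in> {0..1}"
  show "conjugate h (t *\<^sub>R v + (1 - t) *\<^sub>R w)
    \<le> ereal t * conjugate h v + ereal (1 - t) * conjugate h w"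
    unfolding conjugate_def[of h "t *\<^sub>R v + (1 - t) *\<^sub>R w"]
  proof (rule SUP_least)
    fix u
    show "ereal ((t *\<^sub>R v + (1 - t) *\<^sub>R w) u) - h u
      \<le> ereal t * conjugate h v + ereal (1 - t) * conjugate h w"
    proof (cases "h u")
      case (real r)
      have *: "ereal (v u - r) \<le> conjugate h v" "ereal (w u - r) \<le> conjugate h w"
        unfolding conjugate_def using real by (auto intro!: SUP_upper2[of u])
      have "ereal (t * (v u - r)) + ereal ((1 - t) * (w u - r))
         \<le> ereal t * conjugate h v + ereal (1 - t) * conjugate h w"
        using ereal_mult_left_mono[OF *(1), of "ereal t"] ereal_mult_left_mono[OF *(2), of "ereal (1 - t)"] t
        by (intro add_mono) auto
      then show ?thesis
        using real by (simp add: blinfun.bilinear_simps algebra_simps)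
    next
      case PInf then show ?thesis by simp
    next
      case MInf then show ?thesis using assms by (simp add: proper_def)
    qed
  qed
qed

lemma has_gradient_unique:
  assumes "has_gradient f \<xi> u" "has_gradient f \<eta> u"
  shows "\<xi> = \<eta>"
proof (rule blinfun_eqI)
  fix d
  show "\<xi> d = \<eta> d"
    using tendsto_unique[OF _ assms(1)[unfolded has_gradient_def, rule_format, of d]
        assms(2)[unfolded has_gradient_def, rule_format, of d]] by simp
qed

lemma has_gradient_grad:
  assumes "essentially_smooth f" "u \<in> interior (effdom f)"
  shows "has_gradient f (grad f u) u"
proof -
  obtain \<xi> where "has_gradient f \<xi> u"
    using assms unfolding essentially_smooth_def by blast
  then show ?thesis
    unfolding grad_def by (rule theI) (rule has_gradient_unique[OF _ \<open>has_gradient f \<xi> u\<close>])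
qed

text \<open>All values on a segment inside the convex domain are finite, so the extended-real limit
  of \<open>has_gradient\<close> becomes a real one. The point is written as a convex combination so
  that \<open>convex_onD\<close> applies to it.\<close>

lemma grad_difference_quotient:
  assumes "essentially_smooth f" "w \<in> interior (effdom f)" "u \<in> effdom f"
    and "convex (effdom f)" "\<And>v. f v \<noteq> -\<infinity>"
  shows "((\<lambda>t. (fin f ((1 - t) *\<^sub>R w + t *\<^sub>R u) - fin f w) / t) \<longlongrightarrow> grad f w (u - w)) (at_right 0)"
proof -
  have "((\<lambda>t::real. (f (w + t *\<^sub>R (u - w)) - f w) / ereal t) \<longlongrightarrow> ereal (grad f w (u - w))) (at_right 0)"
    using has_gradient_grad[OF assms(1,2)] unfolding has_gradient_def by blast
  moreover have "\<forall>\<^sub>F t in at_right 0. (f (w + t *\<^sub>R (u - w)) - f w) / ereal t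
      = ereal ((fin f ((1 - t) *\<^sub>R w + t *\<^sub>R u) - fin f w) / t)"
  proof (rule eventually_at_rightI[of 0 1])
    fix t :: real assume t: "t \<in> {0<..<1}"
    have w: "w \<in> effdom f" using assms(2) interior_subset by blast
    have eq: "w + t *\<^sub>R (u - w) = (1 - t) *\<^sub>R w + t *\<^sub>R u" by (simp add: algebra_simps)
    have "(1 - t) *\<^sub>R w + t *\<^sub>R u \<in> effdom f"
      using assms(3,4) w t unfolding convex_alt by simp
    then obtain r where r: "f ((1 - t) *\<^sub>R w + t *\<^sub>R u) = ereal r"
      by (rule effdomE[of _ f, OF _ assms(5)])
    obtain s where s: "f w = ereal s"
      by (rule effdomE[OF w assms(5)])
    from r s t show "(f (w + t *\<^sub>R (u - w)) - f w) / ereal t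
      = ereal ((fin f ((1 - t) *\<^sub>R w + t *\<^sub>R u) - fin f w) / t)"
      unfolding eq by simp
  qed simp
  ultimately have "((\<lambda>t. ereal ((fin f ((1 - t) *\<^sub>R w + t *\<^sub>R u) - fin f w) / t))
      \<longlongrightarrow> ereal (grad f w (u - w))) (at_right 0)"
    by (rule Lim_transform_eventually)
  then show ?thesis by simp
qed

text \<open>Strong convexity on the segment from \<open>w\<close> to \<open>u\<close>, divided by
  \<open>t\<close>, bounds the difference quotient of \<open>f\<close> at \<open>w\<close>; then
  \<open>t\<close> tends to 0.\<close>

lemma breg_lower_bound:
  assumes "essentially_smooth f" "w \<in> interior (effdom f)" "u \<in> effdom f"
    and "\<And>v. f v \<noteq> -\<infinity>" "strongly_convex m f" "convex (effdom f)"
  shows "breg f u w \<ge> m / 2 * (norm (u - w))\<^sup>2"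
proof -
  have w: "w \<in> effdom f" using assms(2) interior_subset by blast
  \<comment> \<open>The factor \<open>1 - 0\<close> is the limit of \<open>1 - t\<close>, left
    unsimplified so that \<open>tendsto_intros\<close> produces it.\<close>
  have "grad f w (u - w) \<le> fin f u - fin f w - m / 2 * (1 - 0) * (norm (u - w))\<^sup>2"
  proof (rule tendsto_le[OF _ _ grad_difference_quotient[OF assms(1-3,6,4)]])
    show "((\<lambda>t. fin f u - fin f w - m / 2 * (1 - t) * (norm (u - w))\<^sup>2)
      \<longlongrightarrow> fin f u - fin f w - m / 2 * (1 - 0) * (norm (u - w))\<^sup>2) (at_right 0)"
      by (intro tendsto_intros)
    show "\<forall>\<^sub>F t in at_right 0. (fin f ((1 - t) *\<^sub>R w + t *\<^sub>R u) - fin f w) / t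
      \<le> fin f u - fin f w - m / 2 * (1 - t) * (norm (u - w))\<^sup>2"
    proof (rule eventually_at_rightI[of 0 1])
      fix t :: real assume t: "t \<in> {0<..<1}"
      let ?z = "(1 - t) *\<^sub>R w + t *\<^sub>R u"
      have z: "?z \<in> effdom f" using assms(6,3) w t unfolding convex_alt by simp
      have "f (t *\<^sub>R u + (1 - t) *\<^sub>R w) \<le> ereal t * f u + ereal (1 - t) * f w
         - ereal (m / 2 * t * (1 - t) * (norm (u - w))\<^sup>2)"
        using assms(5)[unfolded strongly_convex_def] assms(3) w t by simp
      then have "fin f ?z \<le> t * fin f u + (1 - t) * fin f w - m / 2 * t * (1 - t) * (norm (u - w))\<^sup>2"
        by - (rule effdomE[OF z assms(4)], rule effdomE[OF w assms(4)], rule effdomE[OF assms(3,4)],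
            simp add: add.commute)
      then show "(fin f ?z - fin f w) / t \<le> fin f u - fin f w - m / 2 * (1 - t) * (norm (u - w))\<^sup>2"
        using t by (simp add: pos_divide_le_eq) (simp add: algebra_simps)
    qed simp
  qed simp
  then show ?thesis by (simp add: breg_def)
qed

section \<open>Local upper bounds by Baire category\<close>

lemma closed_sublevel:
  assumes "lower_semicontinuous (f :: 'a::real_normed_vector \<Rightarrow> ereal)"
  shows "closed {u. f u \<le> c}"
proof -
  have "\<exists>T. open T \<and> u \<in> T \<and> T \<subseteq> {u. c < f u}" if u: "c < f u" for u
  proof -
    have "\<forall>\<^sub>F v in at u. c < f v"
      using u assms unfolding lower_semicontinuous_def by (metis less_LiminfD less_le_trans)
    then obtain T where "open T" "u \<in> T" "\<forall>v\<in>T. v \<noteq> u \<longrightarrow> c < f v"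
      unfolding eventually_at_topological by blast
    then have "T \<subseteq> {u. c < f u}" using u by auto
    then show ?thesis using \<open>open T\<close> \<open>u \<in> T\<close> by blast
  qed
  then have "open {u. c < f u}" by (subst open_subopen) blast
  moreover have "- {u. f u \<le> c} = {u. c < f u}" by auto
  ultimately show ?thesis by (simp add: closed_def)
qed

text \<open>The closed sublevel sets \<open>S n\<close> cover the domain, so by Baire one of them
  contains a ball, about some \<open>z\<close>. A point \<open>q\<close> of the domain beyond
  \<open>w\<close>, seen from \<open>z\<close>, makes \<open>w\<close> a convex combination of
  \<open>q\<close> and \<open>z\<close>; the homothety with centre \<open>q\<close> carries the ball
  to a neighbourhood of \<open>w\<close>, and convexity carries the bound along.\<close>

lemma locally_bounded_above:
  fixes f :: "'a::banach \<Rightarrow> ereal"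
  assumes "f \<in> \<Gamma>\<^sub>0" "w \<in> interior (effdom f)"
  obtains r M where "r > 0" "\<And>e. norm e \<le> r \<Longrightarrow> w + e \<in> effdom f \<and> fin f (w + e) \<le> M"
proof -
  have nm: "\<And>u. f u \<noteq> -\<infinity>" and cf: "convex_fun f" and lsc: "lower_semicontinuous f"
    using assms(1) by (auto simp: \<Gamma>\<^sub>0_def proper_def)
  note con = convex_fun_imp_convex_on[OF cf nm]
  then have cv: "convex (effdom f)" by (simp add: convex_on_def)
  define S where "S n = {u. f u \<le> ereal (real n)}" for n
  have Un: "effdom f = \<Union>(range S)"
  proof safe
    fix u assume "u \<in> effdom f"
    then obtain r where r: "f u = ereal r" by (rule effdomE[of _ f, OF _ nm])
    obtain n where "r \<le> real n" using real_arch_simple by blast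
    then show "u \<in> \<Union>(range S)" using r by (auto simp: S_def)
  next
    fix u n assume "u \<in> S n" then show "u \<in> effdom f" 
      unfolding S_def effdom_def using order.strict_trans1 by fastforce
  qed
  have "\<exists>n. interior (S n) \<noteq> {}"
  proof (rule ccontr)
    assume "\<not> ?thesis"
    moreover have "closed (S n)" for n
      unfolding S_def by (rule closed_sublevel[OF lsc])
    ultimately have "euclidean interior_of \<Union>(range S) = {}"
      by (intro Baire_category_alt) (auto simp: completely_metrizable_space_euclidean)
    then show False using assms(2) Un by auto
  qed
  then obtain n z where "z \<in> interior (S n)" by blast
  then obtain \<epsilon> where \<epsilon>: "\<epsilon> > 0" "ball z \<epsilon> \<subseteq> S n" by (auto simp: mem_interior)
  obtain \<rho> where \<rho>: "\<rho> > 0" "ball w \<rho> \<subseteq> effdom f" using assms(2) by (auto simp: mem_interior)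
  \<comment> \<open>Small enough that \<open>q\<close> stays within \<rho> of \<open>w\<close>; the
    summand 1 covers the case \<open>w = z\<close>.\<close>
  define \<mu> where "\<mu> = \<rho> / (2 * (norm (w - z) + 1))"
  have \<mu>: "\<mu> > 0" using \<rho> by (simp add: \<mu>_def add_nonneg_pos)
  define q where "q = w + \<mu> *\<^sub>R (w - z)"
  have "norm (\<mu> *\<^sub>R (w - z)) < \<rho>"
  proof -
    have "norm (\<mu> *\<^sub>R (w - z)) = \<mu> * norm (w - z)" using \<mu> by simp
    also have "\<dots> \<le> \<mu> * (norm (w - z) + 1)" using \<mu> by simp
    also have "\<dots> = \<rho> / 2"
    proof -
      have "norm (w - z) + 1 \<noteq> 0" using norm_ge_zero[of "w - z"] by linarith
      moreover have "\<rho> / (2 * a) * a = \<rho> / 2" if "a \<noteq> 0" for a :: real using that by simp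
      ultimately show ?thesis unfolding \<mu>_def by blast
    qed
    finally show ?thesis using \<rho> by simp
  qed
  then have "dist w q < \<rho>" by (simp only: q_def dist_norm norm_minus_commute[of w] add_diff_cancel_left')
  then have q: "q \<in> effdom f" using \<rho> by auto
  \<comment> \<open>Obtained by solving \<open>q = w + \<mu> *\<^sub>R (w - z)\<close> for
    \<open>w\<close>.\<close>
  define \<kappa> where "\<kappa> = \<mu> / (1 + \<mu>)"
  have \<kappa>: "0 < \<kappa>" "\<kappa> < 1" using \<mu> by (auto simp: \<kappa>_def)
  have w_eq: "w = (1 - \<kappa>) *\<^sub>R q + \<kappa> *\<^sub>R z"
  proof -
    have "(1 - \<kappa>) * (1 + \<mu>) = 1" "(1 - \<kappa>) * \<mu> = \<kappa>"
      using \<mu> by (auto simp: \<kappa>_def field_simps)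
    moreover have "(1 - \<kappa>) *\<^sub>R q + \<kappa> *\<^sub>R z = ((1 - \<kappa>) * (1 + \<mu>)) *\<^sub>R w - ((1 - \<kappa>) * \<mu>) *\<^sub>R z + \<kappa> *\<^sub>R z"
      by (simp add: q_def algebra_simps)
    ultimately show ?thesis by simp
  qed
  show thesis
  proof (rule that[of "\<kappa> * \<epsilon> / 2" "(1 - \<kappa>) * fin f q + \<kappa> * real n"])
    show "\<kappa> * \<epsilon> / 2 > 0" using \<kappa> \<epsilon> by simp
    fix e :: 'a assume e: "norm e \<le> \<kappa> * \<epsilon> / 2"
    let ?z = "z + (1 / \<kappa>) *\<^sub>R e"
    have "norm ((1 / \<kappa>) *\<^sub>R e) = norm e / \<kappa>" using \<kappa> by simp
    also have "\<dots> \<le> \<epsilon> / 2" using e \<kappa> by (simp add: field_simps)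
    also have "\<dots> < \<epsilon>" using \<epsilon> by simp
    finally have "dist z ?z < \<epsilon>" by (simp add: dist_norm)
    then have "?z \<in> S n" using \<epsilon> by auto
    then have z: "?z \<in> effdom f" and fz: "f ?z \<le> ereal (real n)" using Un by (auto simp: S_def)
    from fz have "fin f ?z \<le> real n" by - (rule effdomE[OF z nm], simp)
    have eq: "w + e = (1 - \<kappa>) *\<^sub>R q + \<kappa> *\<^sub>R ?z" using \<kappa> by (subst w_eq) (simp add: algebra_simps)
    have "w + e \<in> effdom f"
      unfolding eq using cv q z \<kappa> unfolding convex_alt by simp
    moreover have "fin f (w + e) \<le> (1 - \<kappa>) * fin f q + \<kappa> * fin f ?z"
      unfolding eq using \<kappa> q z by (intro convex_onD[OF con]) auto
    moreover have "\<kappa> * fin f ?z \<le> \<kappa> * real n" using \<open>fin f ?z \<le> real n\<close> \<kappa> by simp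
    ultimately show "w + e \<in> effdom f \<and> fin f (w + e) \<le> (1 - \<kappa>) * fin f q + \<kappa> * real n"
      by linarith
  qed
qed

section \<open>A single Bregman proximal step\<close>

text \<open>Covers both updates: the dual one takes \<open>conjugate h\<close> for \<open>g\<close>
  and a negated pairing for \<open>l\<close>; \<open>c\<close> is the inverse step size. The
  conditions on \<open>w\<close> are the invariant of the iteration, and \<open>p_dom\<close> and
  \<open>p_int\<close> hand them on to \<open>p\<close>.\<close>

locale bregman_step =
  fixes g \<phi> :: "'a::banach \<Rightarrow> ereal" and \<gamma> c :: real and l :: "'a \<Rightarrow> real" and w p :: 'a
  assumes g_not_MInf: "g u \<noteq> -\<infinity>"
    and convex_dom: "convex (effdom g)"
    and \<phi>: "\<phi> \<in> \<Gamma>\<^sub>0" "essentially_smooth \<phi>"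
    and pos: "\<gamma> > 0" "c > 0"
    and relatively_convex: "convex_fun (\<lambda>u. g u - ereal \<gamma> * \<phi> u)"
    and linear: "linear l"
    and w_dom: "w \<in> effdom g" and w_int: "w \<in> interior (effdom \<phi>)"
    and minimizer: "is_arg_min (\<lambda>u. g u + ereal (l u) + ereal c * bregman \<phi> u w) (\<lambda>_. True) p"
begin

lemma \<phi>_not_MInf: "\<phi> u \<noteq> -\<infinity>"
  using \<phi>(1) by (simp add: \<Gamma>\<^sub>0_def proper_def)

lemma \<phi>_convex_on: "convex_on (effdom \<phi>) (fin \<phi>)"
  using \<phi>(1) by (intro convex_fun_imp_convex_on \<phi>_not_MInf) (simp add: \<Gamma>\<^sub>0_def)

lemma \<phi>_convex_dom: "convex (effdom \<phi>)"
  using \<phi>_convex_on by (simp add: convex_on_def)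

lemma w_dom_\<phi>: "w \<in> effdom \<phi>"
  using w_int interior_subset by blast

text \<open>If \<^term>\<open>\<phi>\<close> were infinite at some \<open>u\<close> in the domain of \<^term>\<open>g\<close>, the relative convexity would
  propagate the value minus infinity of the difference along the open segment from \<open>u\<close> to \<open>w\<close>.\<close>

lemma dom_subset: "effdom g \<subseteq> effdom \<phi>"
proof
  fix u assume u: "u \<in> effdom g"
  show "u \<in> effdom \<phi>"
  proof (rule ccontr)
    assume "u \<notin> effdom \<phi>"
    then have inf: "\<phi> u = \<infinity>" by (simp add: effdom_def)
    have "((\<lambda>t. t *\<^sub>R u + (1 - t) *\<^sub>R w) \<longlongrightarrow> 0 *\<^sub>R u + (1 - 0) *\<^sub>R w) (at_right (0::real))"
      by (intro tendsto_intros)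
    then have "\<forall>\<^sub>F t in at_right (0::real). t *\<^sub>R u + (1 - t) *\<^sub>R w \<in> interior (effdom \<phi>)"
      using w_int by (intro topological_tendstoD) auto
    moreover have "\<forall>\<^sub>F t in at_right (0::real). 0 < t \<and> t < 1"
      by (rule eventually_at_rightI[of 0 1]) auto
    ultimately have "\<forall>\<^sub>F t in at_right (0::real). t *\<^sub>R u + (1 - t) *\<^sub>R w \<in> interior (effdom \<phi>) \<and> 0 < t \<and> t < 1"
      by (rule eventually_conj)
    then obtain t :: real where t: "t *\<^sub>R u + (1 - t) *\<^sub>R w \<in> interior (effdom \<phi>)" "0 < t" "t < 1"
      using eventually_happens'[OF trivial_limit_at_right_real] by blast
    let ?z = "t *\<^sub>R u + (1 - t) *\<^sub>R w"
    have "?z \<in> effdom \<phi>" using t(1) interior_subset by blast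
    then obtain a where a: "\<phi> ?z = ereal a" by (rule effdomE[of _ \<phi>, OF _ \<phi>_not_MInf])
    obtain b where b: "g u = ereal b" by (rule effdomE[OF u g_not_MInf])
    obtain d where d: "g w = ereal d" by (rule effdomE[OF w_dom g_not_MInf])
    obtain e where e: "\<phi> w = ereal e" by (rule effdomE[OF w_dom_\<phi> \<phi>_not_MInf])
    have "g ?z - ereal \<gamma> * \<phi> ?z \<le> ereal t * (g u - ereal \<gamma> * \<phi> u) + ereal (1 - t) * (g w - ereal \<gamma> * \<phi> w)"
      using t by (intro relatively_convex[unfolded convex_fun_def, rule_format]) auto
    also have "\<dots> = -\<infinity>" using t pos by (simp add: b inf d e)
    finally show False using a g_not_MInf[of ?z] by (cases "g ?z") auto
  qed
qed

lemma relatively_convex_on: "convex_on (effdom g) (\<lambda>u. fin g u - \<gamma> * fin \<phi> u)"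
proof (rule convex_onI[OF _ convex_dom])
  fix t :: real and u v assume h: "0 < t" "t < 1" "u \<in> effdom g" "v \<in> effdom g"
  let ?z = "(1 - t) *\<^sub>R u + t *\<^sub>R v"
  have z: "?z \<in> effdom g" using convex_dom h unfolding convex_alt by simp
  have rep: "\<exists>a b. g x = ereal a \<and> \<phi> x = ereal b" if "x \<in> effdom g" for x
    by (rule effdomE[OF that g_not_MInf], rule effdomE[OF subsetD[OF dom_subset that] \<phi>_not_MInf]) blast
  have "g ((1 - t) *\<^sub>R u + (1 - (1 - t)) *\<^sub>R v) - ereal \<gamma> * \<phi> ((1 - t) *\<^sub>R u + (1 - (1 - t)) *\<^sub>R v)
    \<le> ereal (1 - t) * (g u - ereal \<gamma> * \<phi> u) + ereal (1 - (1 - t)) * (g v - ereal \<gamma> * \<phi> v)"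
    using h by (intro relatively_convex[unfolded convex_fun_def, rule_format]) auto
  then show "fin g ?z - \<gamma> * fin \<phi> ?z \<le> (1 - t) * (fin g u - \<gamma> * fin \<phi> u) + t * (fin g v - \<gamma> * fin \<phi> v)"
    using rep[OF h(3)] rep[OF h(4)] rep[OF z] by auto
qed

text \<open>Comparison with \<open>w\<close>, where the divergence vanishes and the objective is
  finite.\<close>

lemma p_dom: "p \<in> effdom g"
proof -
  have "\<not> (g w + ereal (l w) + ereal c * bregman \<phi> w w < g p + ereal (l p) + ereal c * bregman \<phi> p w)"
    using minimizer by (auto simp: is_arg_min_def)
  moreover have "bregman \<phi> w w = 0"
    using bregman_eq_breg[of \<phi> w w] \<phi>_not_MInf w_dom_\<phi> by (simp add: zero_ereal_def)
  moreover obtain a where "g w = ereal a" by (rule effdomE[OF w_dom g_not_MInf])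
  moreover obtain b where b: "\<phi> w = ereal b" by (rule effdomE[OF w_dom_\<phi> \<phi>_not_MInf])
  moreover have "bregman \<phi> p w \<noteq> -\<infinity>"
    using \<phi>_not_MInf[of p] b by (cases "\<phi> p") (auto simp: bregman_def)
  ultimately show ?thesis
    using pos by (cases "bregman \<phi> p w"; cases "g p") (auto simp: effdom_def)
qed

lemma p_min:
  assumes "u \<in> effdom g"
  shows "fin g p + l p + c * breg \<phi> p w \<le> fin g u + l u + c * breg \<phi> u w"
proof -
  have rep: "\<exists>a. g x = ereal a \<and> bregman \<phi> x w = ereal (breg \<phi> x w)" if "x \<in> effdom g" for x
    using bregman_eq_breg[of \<phi>, OF \<phi>_not_MInf subsetD[OF dom_subset that] w_dom_\<phi>]
    by - (rule effdomE[OF that g_not_MInf], blast)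
  have "\<not> (g u + ereal (l u) + ereal c * bregman \<phi> u w < g p + ereal (l p) + ereal c * bregman \<phi> p w)"
    using minimizer by (auto simp: is_arg_min_def)
  then show ?thesis using rep[OF assms] rep[OF p_dom] by auto
qed

text \<open>First-order optimality of \<^term>\<open>p\<close> in the direction of \<open>u\<close>, before passing to the limit in the
  difference quotient of \<^term>\<open>\<phi>\<close>, which need not exist while \<^term>\<open>p\<close> may lie on the boundary.\<close>

lemma quotient_lower_bound:
  assumes u: "u \<in> effdom g" and t: "0 < t" "t < 1"
  shows "(\<gamma> + c) * ((fin \<phi> ((1 - t) *\<^sub>R p + t *\<^sub>R u) - fin \<phi> p) / t)
    \<ge> - ((fin g u - \<gamma> * fin \<phi> u) - (fin g p - \<gamma> * fin \<phi> p) + (l u - l p) - c * grad \<phi> w (u - p))"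
proof -
  let ?z = "(1 - t) *\<^sub>R p + t *\<^sub>R u"
  have z: "?z \<in> effdom g" using convex_dom u p_dom t unfolding convex_alt by simp
  have l: "l ?z = (1 - t) * l p + t * l u"
    using linear by (simp add: linear_add linear_scale)
  have gr: "grad \<phi> w (?z - w) = grad \<phi> w (p - w) + t * grad \<phi> w (u - p)"
    by (simp add: blinfun.bilinear_simps algebra_simps)
  have cv: "fin g ?z - \<gamma> * fin \<phi> ?z
      \<le> (1 - t) * (fin g p - \<gamma> * fin \<phi> p) + t * (fin g u - \<gamma> * fin \<phi> u)"
    using t u p_dom by (intro convex_onD[OF relatively_convex_on]) auto
  \<comment> \<open>Split \<open>g\<close> into its convex part, bounded by the chord, and \<gamma>
    times \<open>\<phi>\<close>. The latter joins the \<open>c\<close> copies of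
    \<open>\<phi>\<close> from the divergence, whence the factor
    \<open>\<gamma> + c\<close>.\<close>
  have "0 \<le> t * ((fin g u - \<gamma> * fin \<phi> u) - (fin g p - \<gamma> * fin \<phi> p) + (l u - l p) - c * grad \<phi> w (u - p))
      + (\<gamma> + c) * (fin \<phi> ?z - fin \<phi> p)"
    using p_min[OF z] cv unfolding breg_def l gr by (simp add: algebra_simps)
  then have "- (t * ((fin g u - \<gamma> * fin \<phi> u) - (fin g p - \<gamma> * fin \<phi> p) + (l u - l p) - c * grad \<phi> w (u - p)))
      \<le> (\<gamma> + c) * (fin \<phi> ?z - fin \<phi> p)" by linarith
  from divide_right_mono[OF this, of t] show ?thesis using t by simp
qed

text \<open>On the segment from \<^term>\<open>p\<close> to \<^term>\<open>w\<close> the slopes of \<^term>\<open>\<phi>\<close> stay bounded below, and \<^term>\<open>\<phi>\<close> is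
  bounded above near \<^term>\<open>w\<close>; so the gradients along the segment are bounded, which essential
  smoothness excludes if \<^term>\<open>p\<close> is a boundary point.\<close>

lemma p_int: "p \<in> interior (effdom \<phi>)"
proof (rule ccontr)
  assume np: "p \<notin> interior (effdom \<phi>)"
  have p: "p \<in> effdom \<phi>" using p_dom dom_subset by blast
  then have front: "p \<in> frontier (effdom \<phi>)" using np closure_subset unfolding frontier_def by blast
  obtain r M where r: "r > 0" and M: "\<And>e. norm e \<le> r \<Longrightarrow> w + e \<in> effdom \<phi> \<and> fin \<phi> (w + e) \<le> M"
    using locally_bounded_above[OF \<phi>(1) w_int] by blast
  \<comment> \<open>By \<open>quotient_lower_bound\<close> with \<open>u = w\<close>, every slope of
    \<open>\<phi>\<close> from \<open>p\<close> towards \<open>w\<close> is at least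
    \<open>- B\<close>.\<close>
  define B where "B = ((fin g w - \<gamma> * fin \<phi> w) - (fin g p - \<gamma> * fin \<phi> p) + (l w - l p)
    - c * grad \<phi> w (w - p)) / (\<gamma> + c)"
  define z where "z t = (1 - t) *\<^sub>R p + t *\<^sub>R w" for t :: real
  have z_int: "z t \<in> interior (effdom \<phi>)" if t: "0 < t" "t < 1" for t
  proof -
    \<comment> \<open>This ball is the image of the ball of radius \<open>r\<close> about
      \<open>w\<close> under the homothety with centre \<open>p\<close> and ratio
      \<open>t\<close>.\<close>
    have "ball (z t) (t * r) \<subseteq> effdom \<phi>"
    proof
      fix v assume "v \<in> ball (z t) (t * r)"
      then have "norm (v - z t) \<le> t * r" by (simp add: dist_norm norm_minus_commute)
      then have "norm ((1 / t) *\<^sub>R (v - z t)) \<le> r" using t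
        by (simp add: pos_divide_le_eq mult.commute del: scaleR_diff_right scaleR_right_diff_distrib)
      then have "w + (1 / t) *\<^sub>R (v - z t) \<in> effdom \<phi>" using M by blast
      then have "(1 - t) *\<^sub>R p + t *\<^sub>R (w + (1 / t) *\<^sub>R (v - z t)) \<in> effdom \<phi>"
        using \<phi>_convex_dom p t unfolding convex_alt by simp
      then show "v \<in> effdom \<phi>" using t by (simp add: z_def algebra_simps)
    qed
    then show ?thesis using t r unfolding mem_interior by (intro exI[of _ "t * r"]) simp
  qed
  have bound: "norm (grad \<phi> (z t)) \<le> (\<bar>M - fin \<phi> p\<bar> + \<bar>B\<bar>) / r" if t: "0 < t" "t < 1" for t
  proof -
    have "- (B * (\<gamma> + c)) \<le> (\<gamma> + c) * ((fin \<phi> (z t) - fin \<phi> p) / t)"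
      using quotient_lower_bound[OF w_dom t] pos by (simp add: B_def z_def)
    then have "(\<gamma> + c) * (- B) \<le> (\<gamma> + c) * ((fin \<phi> (z t) - fin \<phi> p) / t)"
      by (simp add: algebra_simps)
    then have "- B \<le> (fin \<phi> (z t) - fin \<phi> p) / t"
      using pos by (subst (asm) mult_le_cancel_left_pos) auto
    then have q: "- B * t \<le> fin \<phi> (z t) - fin \<phi> p"
      using t by (simp add: field_simps)
    have z_dom: "z t \<in> effdom \<phi>" using z_int[OF t] interior_subset by blast
    have sub: "grad \<phi> (z t) (v - z t) \<le> fin \<phi> v - fin \<phi> (z t)" if v: "v \<in> effdom \<phi>" for v
    proof (rule tendsto_upperbound[OF grad_difference_quotient[OF \<phi>(2) z_int[OF t] v \<phi>_convex_dom \<phi>_not_MInf]])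
      show "\<forall>\<^sub>F s in at_right 0. (fin \<phi> ((1 - s) *\<^sub>R z t + s *\<^sub>R v) - fin \<phi> (z t)) / s \<le> fin \<phi> v - fin \<phi> (z t)"
      proof (rule eventually_at_rightI[of 0 1])
        fix s :: real assume s: "s \<in> {0<..<1}"
        have "fin \<phi> ((1 - s) *\<^sub>R z t + s *\<^sub>R v) \<le> (1 - s) * fin \<phi> (z t) + s * fin \<phi> v"
          using s v z_dom by (intro convex_onD[OF \<phi>_convex_on]) auto
        then show "(fin \<phi> ((1 - s) *\<^sub>R z t + s *\<^sub>R v) - fin \<phi> (z t)) / s \<le> fin \<phi> v - fin \<phi> (z t)"
          using s by (simp add: pos_divide_le_eq) (simp add: algebra_simps)
      qed simp
    qed simp
    \<comment> \<open>The gradient inequality tested at \<open>p\<close> shows that the slope at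
      \<open>z t\<close> in direction \<open>w - p\<close> also is at least
      \<open>- B\<close>.\<close>
    have "grad \<phi> (z t) (p - z t) = - t * grad \<phi> (z t) (w - p)"
      by (simp add: z_def blinfun.bilinear_simps algebra_simps)
    then have "t * (- B) \<le> t * grad \<phi> (z t) (w - p)" using sub[OF p] q by (simp add: mult.commute)
    then have slope: "- B \<le> grad \<phi> (z t) (w - p)" using t by (simp only: mult_le_cancel_left_pos)
    \<comment> \<open>Test the gradient inequality at \<open>w + e\<close>. The errors
      \<open>B * t\<close> and \<open>(1 - t) * B\<close> add up to \<open>B\<close>, so the bound
      is uniform in \<open>t\<close>.\<close>
    have dir: "grad \<phi> (z t) e \<le> M - fin \<phi> p + B" if e: "norm e \<le> r" for e
    proof -
      have "w + e - z t = (1 - t) *\<^sub>R (w - p) + e" by (simp add: z_def algebra_simps)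
      then have "grad \<phi> (z t) (w + e - z t) = (1 - t) * grad \<phi> (z t) (w - p) + grad \<phi> (z t) e"
        by (simp only: blinfun.add_right blinfun.scaleR_right real_scaleR_def)
      then have "(1 - t) * grad \<phi> (z t) (w - p) + grad \<phi> (z t) e \<le> M - fin \<phi> (z t)"
        using sub[of "w + e"] M[OF e] by linarith
      moreover have "(1 - t) * (- B) \<le> (1 - t) * grad \<phi> (z t) (w - p)"
        using slope t by (intro mult_left_mono) auto
      ultimately show ?thesis using q by (simp add: algebra_simps)
    qed
    show ?thesis
    proof (rule norm_blinfun_bound)
      show "0 \<le> (\<bar>M - fin \<phi> p\<bar> + \<bar>B\<bar>) / r" using r by simp
      fix e
      let ?L = "M - fin \<phi> p + B"
      have "norm (grad \<phi> (z t) e) * r \<le> ?L * norm e"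
      proof (cases "e = 0")
        case False
        have "grad \<phi> (z t) ((r / norm e) *\<^sub>R e) \<le> ?L" "grad \<phi> (z t) (- ((r / norm e) *\<^sub>R e)) \<le> ?L"
          using r False by (auto intro!: dir)
        then have "(r / norm e) * \<bar>grad \<phi> (z t) e\<bar> \<le> ?L"
          by (simp add: blinfun.bilinear_simps abs_if)
        then show ?thesis using False by (simp add: field_simps)
      qed (simp add: blinfun.zero_right)
      also have "\<dots> \<le> (\<bar>M - fin \<phi> p\<bar> + \<bar>B\<bar>) * norm e" by (intro mult_right_mono) auto
      finally show "norm (grad \<phi> (z t) e) \<le> (\<bar>M - fin \<phi> p\<bar> + \<bar>B\<bar>) / r * norm e"
        using r by (simp add: field_simps)
    qed
  qed
  \<comment> \<open>The double successor keeps \<open>s 0\<close> strictly below 1.\<close>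
  define s where "s k = inverse (real (Suc (Suc k)))" for k :: nat
  have s: "0 < s k" "s k < 1" for k by (auto simp: s_def field_simps)
  have "s \<longlonglongrightarrow> 0"
    unfolding s_def by (rule LIMSEQ_Suc[OF LIMSEQ_inverse_real_of_nat])
  then have "(\<lambda>k. z (s k)) \<longlonglongrightarrow> (1 - 0) *\<^sub>R p + 0 *\<^sub>R w"
    unfolding z_def by (intro tendsto_intros)
  then have "(\<lambda>k. z (s k)) \<longlonglongrightarrow> p" by simp
  then have "filterlim (\<lambda>k. norm (grad \<phi> (z (s k)))) at_top sequentially"
    using \<phi>(2)[unfolded essentially_smooth_def, THEN conjunct2, THEN conjunct2, THEN conjunct2,
        rule_format, of "\<lambda>k. z (s k)" p] z_int[OF s] front by simp
  then have "\<forall>\<^sub>F k in sequentially. (\<bar>M - fin \<phi> p\<bar> + \<bar>B\<bar>) / r < norm (grad \<phi> (z (s k)))"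
    by (simp add: filterlim_at_top_dense)
  then obtain k where "(\<bar>M - fin \<phi> p\<bar> + \<bar>B\<bar>) / r < norm (grad \<phi> (z (s k)))"
    using eventually_happens by fastforce
  then show False using bound[OF s, of k] by simp
qed

text \<open>By \<open>p_int\<close> the kernel has a gradient at \<open>p\<close>, so the quotients
  in \<open>quotient_lower_bound\<close> converge; what remains is algebra with the definition of
  \<open>breg\<close>.\<close>

lemma three_point:
  assumes u: "u \<in> effdom g"
  shows "fin g p + l p + c * breg \<phi> p w + (\<gamma> + c) * breg \<phi> u p \<le> fin g u + l u + c * breg \<phi> u w"
proof -
  have u\<phi>: "u \<in> effdom \<phi>" using u dom_subset by blast
  let ?R = "- ((fin g u - \<gamma> * fin \<phi> u) - (fin g p - \<gamma> * fin \<phi> p) + (l u - l p) - c * grad \<phi> w (u - p))"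
  have "?R \<le> (\<gamma> + c) * grad \<phi> p (u - p)"
  proof (rule tendsto_lowerbound)
    show "((\<lambda>t. (\<gamma> + c) * ((fin \<phi> ((1 - t) *\<^sub>R p + t *\<^sub>R u) - fin \<phi> p) / t))
        \<longlongrightarrow> (\<gamma> + c) * grad \<phi> p (u - p)) (at_right 0)"
      by (intro tendsto_mult_left grad_difference_quotient[OF \<phi>(2) p_int u\<phi> \<phi>_convex_dom \<phi>_not_MInf])
    show "\<forall>\<^sub>F t in at_right 0. ?R \<le> (\<gamma> + c) * ((fin \<phi> ((1 - t) *\<^sub>R p + t *\<^sub>R u) - fin \<phi> p) / t)"
      by (rule eventually_at_rightI[of 0 1]) (use quotient_lower_bound[OF u] in auto)
  qed simp
  moreover have "grad \<phi> w (u - w) = grad \<phi> w (u - p) + grad \<phi> w (p - w)"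
    by (simp add: blinfun.diff_right)
  ultimately show ?thesis
    unfolding breg_def by (simp add: algebra_simps)
qed

end

section \<open>Scalar inequalities, geometric averages and the step size\<close>

text \<open>Expand the square of \<open>p * a - k * s * b\<close>. The parameter \<open>k\<close>
  distributes the cost between the two squares; the values 1 and 2 are used later.\<close>

lemma weighted_Young:
  fixes p q s k a b :: real
  assumes "s\<^sup>2 = p * q" "p > 0" "k > 0"
  shows "s * a * b \<le> p * a\<^sup>2 / (2 * k) + k * q * b\<^sup>2 / 2"
proof -
  have "0 \<le> (p * a - k * s * b)\<^sup>2" by simp
  also have "\<dots> = p\<^sup>2 * a\<^sup>2 - 2 * k * p * s * a * b + k\<^sup>2 * s\<^sup>2 * b\<^sup>2"
    by (simp add: power2_eq_square algebra_simps)
  also have "\<dots> = 2 * k * p * (p * a\<^sup>2 / (2 * k) + k * q * b\<^sup>2 / 2 - s * a * b)"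
    unfolding assms(1) using assms by (simp add: power2_eq_square field_simps)
  finally have "2 * k * p * 0 \<le> 2 * k * p * (p * a\<^sup>2 / (2 * k) + k * q * b\<^sup>2 / 2 - s * a * b)"
    by simp
  moreover have "0 < 2 * k * p" using assms by simp
  ultimately show ?thesis by (simp only: mult_le_cancel_left_pos diff_ge_0_iff_ge)
qed

lemma perturbed_contraction_tendsto_zero:
  fixes e d :: "nat \<Rightarrow> real"
  assumes "0 \<le> \<theta>" "\<theta> < 1" "\<And>n. 0 \<le> e n" "\<And>n. e (Suc n) \<le> \<theta> * e n + d n" "d \<longlonglongrightarrow> 0"
  shows "e \<longlonglongrightarrow> 0"
proof (rule LIMSEQ_I)
  fix r :: real assume r: "r > 0"
  then have "\<forall>\<^sub>F n in sequentially. d n < r / 2 * (1 - \<theta>)"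
    using assms(2,5) by (intro order_tendstoD(2)[OF assms(5)]) simp
  then obtain N where N: "\<And>n. n \<ge> N \<Longrightarrow> d n < r / 2 * (1 - \<theta>)"
    by (auto simp: eventually_sequentially)
  \<comment> \<open>\<open>r / 2\<close> is the fixed point of the affine recursion with
    perturbation \<open>r / 2 * (1 - \<theta>)\<close>.\<close>
  have bound: "e (N + m) \<le> \<theta> ^ m * e N + r / 2" for m
  proof (induction m)
    case (Suc m)
    have "e (N + Suc m) \<le> \<theta> * e (N + m) + d (N + m)" using assms(4)[of "N + m"] by simp
    also have "\<dots> \<le> \<theta> * (\<theta> ^ m * e N + r / 2) + r / 2 * (1 - \<theta>)"
      using Suc assms(1) N[of "N + m"] by (intro add_mono mult_left_mono) auto
    finally show ?case by (simp add: field_simps)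
  qed (use r in simp)
  have "(\<lambda>m. \<theta> ^ m * e N) \<longlonglongrightarrow> 0 * e N"
    using assms(1,2) by (intro tendsto_mult_right LIMSEQ_realpow_zero)
  then have "\<forall>\<^sub>F m in sequentially. \<theta> ^ m * e N < r / 2"
    using r by (intro order_tendstoD(2)) auto
  then obtain M where M: "\<And>m. m \<ge> M \<Longrightarrow> \<theta> ^ m * e N < r / 2"
    by (auto simp: eventually_sequentially)
  show "\<exists>no. \<forall>n\<ge>no. norm (e n - 0) < r"
  proof (intro exI allI impI)
    fix n assume n: "n \<ge> N + M"
    show "norm (e n - 0) < r"
    proof -
      have "M \<le> n - N" "N + (n - N) = n" using n by auto
      then show ?thesis using bound[of "n - N"] M[of "n - N"] assms(3)[of n] by simp
    qed
  qed
qed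

lemma geometric_weights_sum:
  fixes \<theta> :: real
  assumes "0 < \<theta>" "\<theta> < 1" "K \<ge> 1"
  shows "(\<Sum>k=1..K. 1 / \<theta> ^ (k - 1)) = (1 - \<theta> ^ K) / ((1 - \<theta>) * \<theta> ^ (K - 1))"
proof -
  \<comment> \<open>Clearing denominators with \<open>\<theta> ^ K\<close> keeps the truncated
    \<open>K - 1\<close> out of the right factor during the induction.\<close>
  have "(\<Sum>k=1..K. 1 / \<theta> ^ (k - 1)) * ((1 - \<theta>) * \<theta> ^ K) = \<theta> * (1 - \<theta> ^ K)" for K
  proof (induction K)
    case (Suc K)
    have "(\<Sum>k=1..Suc K. 1 / \<theta> ^ (k - 1)) * ((1 - \<theta>) * \<theta> ^ Suc K)
        = \<theta> * ((\<Sum>k=1..K. 1 / \<theta> ^ (k - 1)) * ((1 - \<theta>) * \<theta> ^ K)) + (1 - \<theta>) * \<theta>"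
      using assms by (simp add: distrib_right)
    also have "\<dots> = \<theta> * (1 - \<theta> ^ Suc K)" unfolding Suc by (simp add: algebra_simps)
    finally show ?case .
  qed simp
  note scaled = this[of K]
  have pow: "\<theta> * \<theta> ^ (K - 1) = \<theta> ^ K" using assms(3) by (cases K) auto
  have "\<theta> * ((\<Sum>k=1..K. 1 / \<theta> ^ (k - 1)) * ((1 - \<theta>) * \<theta> ^ (K - 1)))
      = (\<Sum>k=1..K. 1 / \<theta> ^ (k - 1)) * ((1 - \<theta>) * (\<theta> * \<theta> ^ (K - 1)))"
    by (simp only: mult_ac)
  also have "\<dots> = \<theta> * (1 - \<theta> ^ K)" by (simp only: pow scaled)
  finally have "(\<Sum>k=1..K. 1 / \<theta> ^ (k - 1)) * ((1 - \<theta>) * \<theta> ^ (K - 1)) = 1 - \<theta> ^ K"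
    using assms by (simp only: mult_cancel_left) simp
  then show ?thesis using assms by (simp add: eq_divide_eq)
qed

text \<open>The weights grow geometrically, so \<open>T K \<le> \<theta> * T (Suc K)\<close>:
  passing to the next average shrinks the old error by \<theta> and adds at most the distance of the
  new term from the limit.\<close>

lemma geometric_average_tendsto:
  fixes z :: "nat \<Rightarrow> 'a::real_normed_vector"
  assumes \<theta>: "0 < \<theta>" "\<theta> < 1" and lim: "z \<longlonglongrightarrow> l"
  shows "(\<lambda>K. (1 / (\<Sum>k=1..K. 1 / \<theta> ^ (k - 1))) *\<^sub>R (\<Sum>k=1..K. (1 / \<theta> ^ (k - 1)) *\<^sub>R z k)) \<longlonglongrightarrow> l"
proof -
  define T where "T K = (\<Sum>k=1..K. 1 / \<theta> ^ (k - 1))" for K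
  define Z where "Z K = (1 / T K) *\<^sub>R (\<Sum>k=1..K. (1 / \<theta> ^ (k - 1)) *\<^sub>R z k)" for K
  have T_Suc: "T (Suc K) = T K + 1 / \<theta> ^ K" for K by (simp add: T_def)
  have T_nonneg: "T K \<ge> 0" for K unfolding T_def using \<theta> by (intro sum_nonneg) auto
  have T_pos: "T (Suc K) > 0" for K
    using T_nonneg[of K] \<theta> by (simp add: T_Suc add_nonneg_pos)
  have T_shift: "T (Suc K) = 1 + T K / \<theta>" for K
  proof (induction K)
    case (Suc K)
    have "T (Suc (Suc K)) = T (Suc K) + 1 / \<theta> ^ K / \<theta>" by (simp add: T_Suc)
    also have "\<dots> = 1 + (T K + 1 / \<theta> ^ K) / \<theta>" unfolding Suc add_divide_distrib by simp
    finally show ?case by (simp add: T_Suc)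
  qed (simp add: T_def)
  \<comment> \<open>For \<open>K = 0\<close> division by zero makes \<open>Z 0\<close> vanish, and
    the identity reads 0 = 0.\<close>
  have TZ: "T K *\<^sub>R Z K = (\<Sum>k=1..K. (1 / \<theta> ^ (k - 1)) *\<^sub>R z k)" for K
    using T_pos[of "K - 1"] by (cases K) (simp_all add: Z_def T_def)
  define e where "e K = norm (Z K - l)" for K
  have "e \<longlonglongrightarrow> 0"
  proof (rule perturbed_contraction_tendsto_zero[where \<theta> = \<theta> and d = "\<lambda>K. norm (z (Suc K) - l)"])
    fix K
    have "T (Suc K) *\<^sub>R (Z (Suc K) - l) = T K *\<^sub>R (Z K - l) + (1 / \<theta> ^ K) *\<^sub>R (z (Suc K) - l)"
      unfolding scaleR_diff_right TZ by (simp add: T_Suc algebra_simps)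
    then have "norm (T (Suc K) *\<^sub>R (Z (Suc K) - l)) \<le> norm (T K *\<^sub>R (Z K - l)) + norm ((1 / \<theta> ^ K) *\<^sub>R (z (Suc K) - l))"
      by (simp only: norm_triangle_ineq)
    then have "T (Suc K) * e (Suc K) \<le> T K * e K + (1 / \<theta> ^ K) * norm (z (Suc K) - l)"
      using T_nonneg \<theta> unfolding e_def norm_scaleR by simp
    also have "\<dots> \<le> (\<theta> * T (Suc K)) * e K + T (Suc K) * norm (z (Suc K) - l)"
    proof (intro add_mono mult_right_mono)
      show "T K \<le> \<theta> * T (Suc K)" using \<theta> by (simp add: T_shift algebra_simps)
      show "1 / \<theta> ^ K \<le> T (Suc K)" using T_nonneg[of K] by (simp add: T_Suc)
    qed (auto simp: e_def)
    finally have "T (Suc K) * e (Suc K) \<le> T (Suc K) * (\<theta> * e K + norm (z (Suc K) - l))"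
      by (simp add: algebra_simps)
    then show "e (Suc K) \<le> \<theta> * e K + norm (z (Suc K) - l)"
      using T_pos[of K] by (simp only: mult_le_cancel_left_pos)
  next
    show "(\<lambda>K. norm (z (Suc K) - l)) \<longlonglongrightarrow> 0"
      using LIMSEQ_Suc[OF lim] by (intro tendsto_norm_zero) (simp add: LIM_zero)
  qed (use \<theta> in \<open>auto simp: e_def\<close>)
  then have "Z \<longlonglongrightarrow> l"
    unfolding e_def by (simp add: tendsto_norm_zero_iff LIM_zero_iff)
  then show ?thesis by (simp add: Z_def[abs_def] T_def)
qed

lemma convex_on_weighted_average:
  fixes f :: "'a::real_vector \<Rightarrow> real" and w :: "nat \<Rightarrow> real"
  assumes "convex_on C f" "finite I" "I \<noteq> {}" "\<And>i. i \<in> I \<Longrightarrow> w i > 0" "\<And>i. i \<in> I \<Longrightarrow> z i \<in> C"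
  shows "(1 / sum w I) *\<^sub>R (\<Sum>i\<in>I. w i *\<^sub>R z i) \<in> C"
    and "sum w I * f ((1 / sum w I) *\<^sub>R (\<Sum>i\<in>I. w i *\<^sub>R z i)) \<le> (\<Sum>i\<in>I. w i * f (z i))"
proof -
  have W: "sum w I > 0" using assms by (intro sum_pos) auto
  have eq: "(1 / sum w I) *\<^sub>R (\<Sum>i\<in>I. w i *\<^sub>R z i) = (\<Sum>i\<in>I. (w i / sum w I) *\<^sub>R z i)"
    by (simp add: scaleR_sum_right)
  have one: "(\<Sum>i\<in>I. w i / sum w I) = 1" using W by (simp add: sum_divide_distrib[symmetric])
  have nonneg: "w i / sum w I \<ge> 0" if "i \<in> I" for i using assms(4)[OF that] W by simp
  show "(1 / sum w I) *\<^sub>R (\<Sum>i\<in>I. w i *\<^sub>R z i) \<in> C"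
    unfolding eq using assms one nonneg by (intro convex_sum) (auto simp: convex_on_def)
  have "f ((1 / sum w I) *\<^sub>R (\<Sum>i\<in>I. w i *\<^sub>R z i)) \<le> (\<Sum>i\<in>I. w i / sum w I * f (z i))"
    unfolding eq using assms one nonneg by (intro convex_on_sum) auto
  from mult_left_mono[OF this less_imp_le[OF W]]
  show "sum w I * f ((1 / sum w I) *\<^sub>R (\<Sum>i\<in>I. w i *\<^sub>R z i)) \<le> (\<Sum>i\<in>I. w i * f (z i))"
    using W by (simp add: sum_distrib_left)
qed

text \<open>\<theta> is the smaller root of the displayed quadratic equation; positivity is read off
  from it, since its left side is positive.\<close>

lemma step_size_root:
  fixes c :: real
  assumes "c > 0"
  defines "\<theta> \<equiv> 1 - c / 2 * (sqrt (1 + 4 / c) - 1)"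
  shows "0 < \<theta>" "\<theta> < 1" "(1 - \<theta>)\<^sup>2 = c * \<theta>"
proof -
  define r where "r = sqrt (1 + 4 / c)"
  have r2: "r\<^sup>2 = 1 + 4 / c" and r1: "r > 1" using assms(1) by (auto simp: r_def)
  have \<theta>: "\<theta> = 1 - c / 2 * (r - 1)" by (simp add: \<theta>_def r_def)
  show "\<theta> < 1" using r1 assms(1) by (simp add: \<theta>)
  have "(1 - \<theta>)\<^sup>2 = c\<^sup>2 / 4 * (r\<^sup>2 - 2 * r + 1)" 
    by (simp add: \<theta> power_mult_distrib power_divide power2_diff)
  also have "\<dots> = c\<^sup>2 / 4 * (1 + 1 - 2 * r) + c"
    unfolding r2 using assms(1) by (simp add: power2_eq_square algebra_simps)
  also have "\<dots> = c * \<theta>" unfolding \<theta> by (simp add: power2_eq_square field_simps)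
  finally show eq: "(1 - \<theta>)\<^sup>2 = c * \<theta>" .
  have "(1 - \<theta>)\<^sup>2 > 0" using \<open>\<theta> < 1\<close> by simp
  then show "0 < \<theta>" using eq assms(1) by (simp add: zero_less_mult_iff)
qed

text \<open>Compare with points \<open>u0\<close>, \<open>v0\<close> of finite value. Finiteness of
  \<open>g u\<close> must come first: only then does an infinite \<open>conjugate h v\<close> give
  the Lagrangian the value -\<infinity>, because \<infinity> - \<infinity> is \<infinity>.\<close>

lemma saddle_point_lagrangian_dom:
  assumes "saddle_point (lagrangian g h A) u v" "proper h"
    and g: "\<And>z. g z \<noteq> -\<infinity>" "effdom g \<noteq> {}" "effdom (conjugate h) \<noteq> {}"
  shows "u \<in> effdom g" "v \<in> effdom (conjugate h)"
proof -
  obtain u0 v0 where 0: "u0 \<in> effdom g" "v0 \<in> effdom (conjugate h)" using assms by blast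
  note nm = conjugate_not_MInf[OF assms(2)]
  obtain a where a: "g u0 = ereal a" by (rule effdomE[OF 0(1) g(1)])
  obtain b where b: "conjugate h v0 = ereal b" by (rule effdomE[OF 0(2) nm])
  have 1: "lagrangian g h A u v0 \<le> lagrangian g h A u v" "lagrangian g h A u v \<le> lagrangian g h A u0 v"
    using assms(1) by (auto simp: saddle_point_def)
  then show u: "u \<in> effdom g"
    using a b nm[of v] by (cases "g u"; cases "conjugate h v") (auto simp: lagrangian_def effdom_def)
  obtain c where "g u = ereal c" by (rule effdomE[OF u g(1)])
  with 1 b show "v \<in> effdom (conjugate h)"
    by (cases "conjugate h v") (auto simp: lagrangian_def effdom_def)
qed

lemma dom_subdiff_subset: "dom_subdiff f \<subseteq> effdom f"
  by (auto simp: dom_subdiff_def subdiff_def effdom_def)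

text \<open>Excluding -\<infinity> keeps opposite infinities from meeting, so negation distributes
  over the sum.\<close>

lemma is_arg_max_imp_is_arg_min:
  assumes "is_arg_max (\<lambda>v. - f v + ereal (l v) - q v) P p" "\<And>v. f v \<noteq> -\<infinity>" "\<And>v. q v \<noteq> -\<infinity>"
  shows "is_arg_min (\<lambda>v. f v + ereal (- l v) + q v) P p"
proof -
  have "f v + ereal (- l v) + q v = - (- f v + ereal (l v) - q v)" for v
    using assms(2)[of v] assms(3)[of v] by (cases "f v"; cases "q v") auto
  then show ?thesis
    using assms(1) by (simp add: is_arg_min_def is_arg_max_def)
qed

theorem proposition4p3:
  fixes A :: "'a::banach \<Rightarrow>\<^sub>L 'b::banach"
    and g \<phi>X :: "'a \<Rightarrow> ereal"
    and h :: "'b \<Rightarrow> ereal"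
    and \<phi>Y :: "'b dual \<Rightarrow> ereal"
    and \<gamma>g \<gamma>h \<theta> \<tau> \<sigma> :: real
    and x X :: "nat \<Rightarrow> 'a" and xs :: 'a
    and y Y :: "nat \<Rightarrow> 'b dual" and ys :: "'b dual"
    and T :: "nat \<Rightarrow> real"
    and \<L> :: "'a \<Rightarrow> 'b dual \<Rightarrow> ereal"
    and \<Delta> :: "nat \<Rightarrow> 'a \<Rightarrow> 'b dual \<Rightarrow> ereal"
  assumes reflexive: "reflexive_space TYPE('a)" "reflexive_space TYPE('b)"
    and A_nonzero: "A \<noteq> 0"
    and A1: "g \<in> \<Gamma>\<^sub>0" "h \<in> \<Gamma>\<^sub>0"
      "\<exists>z. is_arg_min (\<lambda>z. g z + h (A z)) (\<lambda>_. True) z"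
      "\<exists>z\<in>effdom g. A z \<in> effdom h \<and> isCont h (A z)"
    and A2: "\<phi>X \<in> \<Gamma>\<^sub>0" "essentially_smooth \<phi>X" "essentially_strictly_convex \<phi>X"
      "\<phi>Y \<in> \<Gamma>\<^sub>0" "essentially_smooth \<phi>Y" "essentially_strictly_convex \<phi>Y"
    and A3: "dom_subdiff g \<subseteq> interior (effdom \<phi>X)"
      "supercoercive g \<or> supercoercive \<phi>X"
    and A4: "dom_subdiff (conjugate h) \<subseteq> interior (effdom \<phi>Y)"
      "supercoercive (conjugate h) \<or> supercoercive \<phi>Y"
    and A5: "strongly_convex 1 \<phi>X" "strongly_convex 1 \<phi>Y"
    and A6: "\<gamma>g > 0" "convex_fun (\<lambda>u. g u - ereal \<gamma>g * \<phi>X u)"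
    and A7: "\<gamma>h > 0" "convex_fun (\<lambda>v. conjugate h v - ereal \<gamma>h * \<phi>Y v)"
    and theta: "\<theta> = 1 - \<gamma>g * \<gamma>h / (2 * (norm A)\<^sup>2) * (sqrt (1 + 4 * (norm A)\<^sup>2 / (\<gamma>g * \<gamma>h)) - 1)"
    and tau: "\<tau> = (1 - \<theta>) / (\<gamma>g * \<theta>)"
    and sigma: "\<sigma> = (1 - \<theta>) / (\<gamma>h * \<theta>)"
    and lagr: "\<L> = lagrangian g h A"
    and saddle: "saddle_point \<L> xs ys"
    and init: "x 0 \<in> dom_subdiff g" "y 0 \<in> dom_subdiff (conjugate h)"
    and x_step: "\<And>k. is_arg_min
      (\<lambda>u. g u + ereal ((y k + \<theta> *\<^sub>R (y k - previous y k)) (A u)) + ereal (1 / \<tau>) * bregman \<phi>X u (x k))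
      (\<lambda>_. True) (x (Suc k))"
    and y_step: "\<And>k. is_arg_max
      (\<lambda>v. - conjugate h v + ereal (v (A (x (Suc k)))) - ereal (1 / \<sigma>) * bregman \<phi>Y v (y k))
      (\<lambda>_. True) (y (Suc k))"
    and T: "T = (\<lambda>K. \<Sum>k=1..K. 1 / \<theta> ^ (k - 1))"
    and X: "X = (\<lambda>K. (1 / T K) *\<^sub>R (\<Sum>k=1..K. (1 / \<theta> ^ (k - 1)) *\<^sub>R x k))"
    and Y: "Y = (\<lambda>K. (1 / T K) *\<^sub>R (\<Sum>k=1..K. (1 / \<theta> ^ (k - 1)) *\<^sub>R y k))"
    and Delta: "\<Delta> = (\<lambda>k u v.
        ereal (1 / \<tau>) * bregman \<phi>X u (x k) + ereal (1 / \<sigma>) * bregman \<phi>Y v (y k)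
        + ereal (\<theta> / \<sigma>) * bregman \<phi>Y (y k) (previous y k)
        + ereal (\<theta> * (y k - previous y k) (A (u - x k))))"
  shows "(\<forall>K\<ge>1. T K = (1 - \<theta> ^ K) / ((1 - \<theta>) * \<theta> ^ (K - 1)))
    \<and> (\<forall>u\<in>effdom g. \<forall>v\<in>effdom (conjugate h). \<forall>k.
         \<L> (x (Suc k)) v - \<L> u (y (Suc k)) \<le> \<Delta> k u v - \<Delta> (Suc k) u v / ereal \<theta>)
    \<and> (\<forall>u\<in>effdom g. \<forall>v\<in>effdom (conjugate h). \<forall>K\<ge>1.
         ereal (T K) * (\<L> (X K) v - \<L> u (Y K)) \<le> \<Delta> 0 u v - ereal (1 / \<theta> ^ K) * \<Delta> K u v)
    \<and> (\<forall>K. ereal (1 / \<sigma>) * bregman \<phi>Y ys (y K) \<le> \<Delta> K xs ys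
         \<and> \<Delta> K xs ys \<le> ereal (\<theta> ^ K) * \<Delta> 0 xs ys)
    \<and> (\<lambda>k. (x k, y k)) \<longlonglongrightarrow> (xs, ys)
    \<and> (\<lambda>K. (X K, Y K)) \<longlonglongrightarrow> (xs, ys)"
proof -

  \<comment> \<open>Step-size identities and the coupling bound\<close>
  let ?h = "conjugate h"
  define c where "c = \<gamma>g * \<gamma>h / (norm A)\<^sup>2"
  have nA: "norm A > 0" using A_nonzero by simp
  have c: "c > 0" using A6(1) A7(1) nA by (simp add: c_def)
  have \<theta>_c: "\<theta> = 1 - c / 2 * (sqrt (1 + 4 / c) - 1)"
    unfolding theta c_def by (simp add: mult.commute)
  note \<theta> = step_size_root[OF c, folded \<theta>_c]
  have \<tau>: "\<tau> > 0" and \<sigma>: "\<sigma> > 0" using \<theta> A6(1) A7(1) by (auto simp: tau sigma)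
  have inv_\<tau>: "\<gamma>g + 1 / \<tau> = 1 / \<tau> / \<theta>" and inv_\<sigma>: "\<gamma>h + 1 / \<sigma> = 1 / \<sigma> / \<theta>"
    using \<theta>(1,2) A6(1) A7(1) by (simp_all add: tau sigma field_simps)
  \<comment> \<open>The form of \<theta> |A|^2 \<tau> \<sigma> = 1 that
    \<open>weighted_Young\<close> asks for; the quadratic equation for \<theta> enters here.\<close>
  have product: "(\<theta> * norm A)\<^sup>2 = 1 / \<tau> * (\<theta> / \<sigma>)"
  proof -
    have "(1 - \<theta>)\<^sup>2 * (norm A)\<^sup>2 = \<gamma>g * \<gamma>h * \<theta>"
      unfolding \<theta>(3) using nA by (simp add: c_def)
    then have "\<theta>\<^sup>2 * (norm A)\<^sup>2 * (1 - \<theta>)\<^sup>2 = \<theta>\<^sup>2 * (\<gamma>g * \<gamma>h * \<theta>)" by (simp add: ac_simps)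
    then have "\<theta>\<^sup>2 * (norm A)\<^sup>2 = \<theta>\<^sup>2 * (\<gamma>g * \<gamma>h * \<theta>) / (1 - \<theta>)\<^sup>2"
      using \<theta>(2) by (simp add: eq_divide_eq)
    also have "\<dots> = 1 / \<tau> * (\<theta> / \<sigma>)" by (simp add: tau sigma power2_eq_square)
    finally show ?thesis by (simp add: power_mult_distrib)
  qed
  have coupling: "\<bar>\<theta> * v (A d)\<bar> \<le> 1 / \<tau> * (norm d)\<^sup>2 / (2 * k) + k * (\<theta> / \<sigma>) * (norm v)\<^sup>2 / 2"
    if "k > 0" for v :: "'b dual" and d k
  proof -
    have "\<bar>v (A d)\<bar> \<le> norm v * norm (A d)" using norm_blinfun[of v "A d"] by simp
    also have "\<dots> \<le> norm v * (norm A * norm d)" by (intro mult_left_mono norm_blinfun) simp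
    finally have "\<bar>\<theta> * v (A d)\<bar> \<le> \<theta> * norm A * norm d * norm v"
      using \<theta>(1) by (simp add: abs_mult ac_simps)
    also have "\<dots> \<le> 1 / \<tau> * (norm d)\<^sup>2 / (2 * k) + k * (\<theta> / \<sigma>) * (norm v)\<^sup>2 / 2"
      using \<tau> that by (intro weighted_Young[OF product]) auto
    finally show ?thesis .
  qed

  \<comment> \<open>Domains of the iterates and of the saddle point\<close>
  have nm: "g u \<noteq> -\<infinity>" "?h v \<noteq> -\<infinity>" "\<phi>X u \<noteq> -\<infinity>" "\<phi>Y v \<noteq> -\<infinity>" for u v
    using A1(1,2) A2(1,4) by (auto simp: \<Gamma>\<^sub>0_def proper_def intro!: conjugate_not_MInf)
  have g_conv: "convex_on (effdom g) (fin g)"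
    using A1(1) nm(1) by (intro convex_fun_imp_convex_on) (auto simp: \<Gamma>\<^sub>0_def)
  have h_conv: "convex_on (effdom ?h) (fin ?h)"
    using A1(2) nm(2) by (intro convex_fun_imp_convex_on convex_fun_conjugate) (auto simp: \<Gamma>\<^sub>0_def)
  have x0: "x 0 \<in> effdom g" "x 0 \<in> interior (effdom \<phi>X)"
    and y0: "y 0 \<in> effdom ?h" "y 0 \<in> interior (effdom \<phi>Y)"
    using init A3(1) A4(1) dom_subdiff_subset by blast+
  have xs: "xs \<in> effdom g" and ys: "ys \<in> effdom ?h"
    using saddle_point_lagrangian_dom[of g h A xs ys] saddle A1(2) nm(1) x0(1) y0(1)
    by (auto simp: lagr \<Gamma>\<^sub>0_def)

  \<comment> \<open>The step facts are conditional at first, to drive the inductions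
    \<open>x_dom\<close> and \<open>y_dom\<close>, and are restated without conditions afterwards.
    The two inductions are separate because the linear term of a step may be arbitrary.\<close>
  have stepX: "bregman_step g \<phi>X \<gamma>g (1 / \<tau>) (\<lambda>u. (y k + \<theta> *\<^sub>R (y k - previous y k)) (A u)) (x k) (x (Suc k))"
    if "x k \<in> effdom g" "x k \<in> interior (effdom \<phi>X)" for k
  proof (rule bregman_step.intro)
    show "linear (\<lambda>u. (y k + \<theta> *\<^sub>R (y k - previous y k)) (A u))"
      by (rule linearI) (simp_all add: blinfun.bilinear_simps algebra_simps)
  qed (use that nm A2 A6 \<tau> g_conv x_step[of k] in \<open>auto simp: convex_on_def\<close>)
  have stepY: "bregman_step ?h \<phi>Y \<gamma>h (1 / \<sigma>) (\<lambda>v. - v (A (x (Suc k)))) (y k) (y (Suc k))"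
    if y: "y k \<in> effdom ?h" "y k \<in> interior (effdom \<phi>Y)" for k
  proof (rule bregman_step.intro)
    show "linear (\<lambda>v. - blinfun_apply v (A (x (Suc k))))"
      by (rule linearI) (simp_all add: blinfun.bilinear_simps algebra_simps)
    obtain b where "\<phi>Y (y k) = ereal b"
      using y interior_subset by (blast intro: effdomE[of "y k" \<phi>Y, OF _ nm(4)])
    then have "ereal (1 / \<sigma>) * bregman \<phi>Y v (y k) \<noteq> -\<infinity>" for v
      using nm(4)[of v] \<sigma> by (cases "\<phi>Y v") (auto simp: bregman_def)
    then show "is_arg_min (\<lambda>v. ?h v + ereal (- v (A (x (Suc k)))) + ereal (1 / \<sigma>) * bregman \<phi>Y v (y k))
        (\<lambda>_. True) (y (Suc k))"
      using y_step[of k] nm(2) by (intro is_arg_max_imp_is_arg_min) auto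
  qed (use y nm A2 A7 \<sigma> h_conv in \<open>auto simp: convex_on_def\<close>)
  have x_dom: "x k \<in> effdom g \<and> x k \<in> interior (effdom \<phi>X)" for k
    by (induction k) (use x0 bregman_step.p_dom[OF stepX] bregman_step.p_int[OF stepX] in auto)
  have y_dom: "y k \<in> effdom ?h \<and> y k \<in> interior (effdom \<phi>Y)" for k
    by (induction k) (use y0 bregman_step.p_dom[OF stepY] bregman_step.p_int[OF stepY] in auto)
  have stepX: "bregman_step g \<phi>X \<gamma>g (1 / \<tau>) (\<lambda>u. (y k + \<theta> *\<^sub>R (y k - previous y k)) (A u)) (x k) (x (Suc k))"
    and stepY: "bregman_step ?h \<phi>Y \<gamma>h (1 / \<sigma>) (\<lambda>v. - v (A (x (Suc k)))) (y k) (y (Suc k))" for k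
    using stepX stepY x_dom y_dom by blast+
  have domX: "effdom g \<subseteq> effdom \<phi>X" and domY: "effdom ?h \<subseteq> effdom \<phi>Y"
    using bregman_step.dom_subset[OF stepX] bregman_step.dom_subset[OF stepY] by blast+
  have prev_dom: "previous y k \<in> effdom ?h \<and> previous y k \<in> interior (effdom \<phi>Y)" for k
    using y_dom by (cases k) auto

  have bregX: "bregman \<phi>X u (x k) = ereal (breg \<phi>X u (x k))"
      "breg \<phi>X u (x k) \<ge> (norm (u - x k))\<^sup>2 / 2" if "u \<in> effdom g" for u k
    using that domX x_dom[of k] bregman_step.\<phi>_convex_dom[OF stepX] nm(3) A2(2) A5(1)
      breg_lower_bound[of \<phi>X "x k" u 1]
    by (auto intro: bregman_eq_breg)
  have bregY: "bregman \<phi>Y v w = ereal (breg \<phi>Y v w)" "breg \<phi>Y v w \<ge> (norm (v - w))\<^sup>2 / 2"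
    if "v \<in> effdom ?h" "w \<in> effdom ?h \<and> w \<in> interior (effdom \<phi>Y)" for v w
    using that domY bregman_step.\<phi>_convex_dom[OF stepY] nm(4) A2(5) A5(2)
      breg_lower_bound[of \<phi>Y w v 1]
    by (auto intro: bregman_eq_breg)

  \<comment> \<open>Real counterparts of \<open>\<L>\<close> and \<open>\<Delta>\<close>, equal to
    them on the effective domains.\<close>
  define Lr where "Lr u v = fin g u + v (A u) - fin ?h v" for u and v :: "'b dual"
  define \<Delta>r where "\<Delta>r k u v = 1 / \<tau> * breg \<phi>X u (x k) + 1 / \<sigma> * breg \<phi>Y v (y k)
    + \<theta> / \<sigma> * breg \<phi>Y (y k) (previous y k) + \<theta> * (y k - previous y k) (A (u - x k))" for k u v
  have L_eq: "\<L> u v = ereal (Lr u v)" if "u \<in> effdom g" "v \<in> effdom ?h" for u v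
    by (rule effdomE[OF that(1) nm(1)], rule effdomE[OF that(2) nm(2)]) (simp add: lagr lagrangian_def Lr_def)
  have \<Delta>_eq: "\<Delta> k u v = ereal (\<Delta>r k u v)" if "u \<in> effdom g" "v \<in> effdom ?h" for k u v
    using bregX(1)[OF that(1)] bregY(1)[OF that(2) y_dom] bregY(1)[OF _ prev_dom] y_dom
    by (simp add: Delta \<Delta>r_def)

  \<comment> \<open>One-step descent\<close>
  have descent: "Lr (x (Suc k)) v - Lr u (y (Suc k)) \<le> \<Delta>r k u v - \<Delta>r (Suc k) u v / \<theta>"
    if u: "u \<in> effdom g" and v: "v \<in> effdom ?h" for k u v
  proof -
    define \<delta> where "\<delta> = y k - previous y k"
    have 1: "fin g (x (Suc k)) + (y k + \<theta> *\<^sub>R \<delta>) (A (x (Suc k))) + 1 / \<tau> * breg \<phi>X (x (Suc k)) (x k)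
        + 1 / \<tau> / \<theta> * breg \<phi>X u (x (Suc k)) \<le> fin g u + (y k + \<theta> *\<^sub>R \<delta>) (A u) + 1 / \<tau> * breg \<phi>X u (x k)"
      using bregman_step.three_point[OF stepX u, of k] unfolding inv_\<tau> \<delta>_def .
    have 2: "fin ?h (y (Suc k)) + - y (Suc k) (A (x (Suc k))) + 1 / \<sigma> * breg \<phi>Y (y (Suc k)) (y k)
        + 1 / \<sigma> / \<theta> * breg \<phi>Y v (y (Suc k)) \<le> fin ?h v + - v (A (x (Suc k))) + 1 / \<sigma> * breg \<phi>Y v (y k)"
      using bregman_step.three_point[OF stepY v, of k] unfolding inv_\<sigma> .
    \<comment> \<open>Adding 1 and 2 leaves the pairing of y_k - y_(k+1) + \<theta> \<delta> with A
      (u - x_(k+1)). Its first part is the pairing in \<Delta>_(k+1)/\<theta>; splitting u - x_(k+1)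
      at x_k turns the second into the pairing in \<Delta>_k and the remainder bounded here.\<close>
    have 3: "- (\<theta> * \<delta> (A (x (Suc k) - x k)))
        \<le> 1 / \<tau> * breg \<phi>X (x (Suc k)) (x k) + \<theta> / \<sigma> * breg \<phi>Y (y k) (previous y k)"
    proof -
      have "1 / \<tau> * ((norm (x (Suc k) - x k))\<^sup>2 / 2) \<le> 1 / \<tau> * breg \<phi>X (x (Suc k)) (x k)"
        using bregX(2)[of "x (Suc k)" k] x_dom[of "Suc k"] \<tau> by (intro mult_left_mono) auto
      moreover have "\<theta> / \<sigma> * ((norm \<delta>)\<^sup>2 / 2) \<le> \<theta> / \<sigma> * breg \<phi>Y (y k) (previous y k)"
        using bregY(2)[OF _ prev_dom, of "y k" k] y_dom[of k] \<sigma> \<theta>(1) unfolding \<delta>_def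
        by (intro mult_left_mono) auto
      ultimately show ?thesis
        using coupling[of 1 \<delta> "x (Suc k) - x k"] by simp
    qed
    have 4: "\<Delta>r (Suc k) u v / \<theta> = 1 / \<tau> / \<theta> * breg \<phi>X u (x (Suc k)) + 1 / \<sigma> / \<theta> * breg \<phi>Y v (y (Suc k))
      + 1 / \<sigma> * breg \<phi>Y (y (Suc k)) (y k) + (y (Suc k) - y k) (A (u - x (Suc k)))"
      using \<theta>(1) by (simp add: \<Delta>r_def add_divide_distrib)
    show ?thesis
      unfolding 4 using 1 2 3 unfolding \<Delta>r_def Lr_def \<delta>_def[symmetric]
      by (simp add: blinfun.bilinear_simps algebra_simps)
  qed

  \<comment> \<open>Geometric decay and convergence of the iterates\<close>
  have saddle_r: "Lr (x k) ys - Lr xs (y k) \<ge> 0" for k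
  proof -
    have "\<L> xs (y k) \<le> \<L> (x k) ys" using saddle unfolding saddle_point_def by (meson order_trans)
    then show ?thesis using L_eq x_dom y_dom xs ys by simp
  qed
  have decay: "\<Delta>r K xs ys \<le> \<theta> ^ K * \<Delta>r 0 xs ys" for K
  proof (induction K)
    case (Suc K)
    have "\<Delta>r (Suc K) xs ys / \<theta> \<le> \<Delta>r K xs ys"
      using descent[OF xs ys, of K] saddle_r[of "Suc K"] by linarith
    then have "\<Delta>r (Suc K) xs ys \<le> \<theta> * \<Delta>r K xs ys" using \<theta>(1) by (simp add: divide_le_eq mult.commute)
    also have "\<dots> \<le> \<theta> * (\<theta> ^ K * \<Delta>r 0 xs ys)" using Suc \<theta>(1) by (intro mult_left_mono) auto
    finally show ?case by (simp add: ac_simps)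
  qed simp
  \<comment> \<open>With \<open>k = 1\<close> both correction terms cancel, which gives the lower
    bound in (b). With \<open>k = 2\<close> part of the primal distance survives, at the cost of the
    last dual increment.\<close>
  have \<Delta>_lower: "1 / \<sigma> * breg \<phi>Y v (y K) + 1 / \<tau> * (norm (u - x K))\<^sup>2 / 2 * (1 - 1 / k)
      \<le> \<Delta>r K u v + (k - 1) * (\<theta> / \<sigma>) * (norm (y K - previous y K))\<^sup>2 / 2"
    if u: "u \<in> effdom g" and "k > 0" for u v k K
  proof -
    have "1 / \<tau> * ((norm (u - x K))\<^sup>2 / 2) \<le> 1 / \<tau> * breg \<phi>X u (x K)"
      using bregX(2)[OF u, of K] \<tau> by (intro mult_left_mono) auto
    moreover have "\<theta> / \<sigma> * ((norm (y K - previous y K))\<^sup>2 / 2) \<le> \<theta> / \<sigma> * breg \<phi>Y (y K) (previous y K)"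
      using bregY(2)[OF _ prev_dom, of "y K" K] y_dom[of K] \<sigma> \<theta>(1) by (intro mult_left_mono) auto
    moreover have split: "1 / \<tau> * a / 2 * (1 - 1 / k) = 1 / \<tau> * (a / 2) - 1 / \<tau> * a / (2 * k)"
      "(k - 1) * (\<theta> / \<sigma>) * a / 2 = k * (\<theta> / \<sigma>) * a / 2 - \<theta> / \<sigma> * (a / 2)" for a
      by (simp_all add: algebra_simps diff_divide_distrib)
    ultimately show ?thesis
      using abs_le_D2[OF coupling[OF \<open>k > 0\<close>, of "y K - previous y K" "u - x K"]]
      unfolding \<Delta>r_def split by linarith
  qed
  have \<Delta>_lower1: "1 / \<sigma> * breg \<phi>Y v (y K) \<le> \<Delta>r K u v" if "u \<in> effdom g" for u v K
    using \<Delta>_lower[OF that, of 1 v K] by simp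

  have \<Delta>_lim: "(\<lambda>K. \<theta> ^ K * \<Delta>r 0 xs ys) \<longlonglongrightarrow> 0"
    using tendsto_mult_right[OF LIMSEQ_realpow_zero[of \<theta>], of "\<Delta>r 0 xs ys"] \<theta>(1,2) by simp
  have "(\<lambda>K. (norm (y K - ys))\<^sup>2) \<longlonglongrightarrow> 0"
  proof (rule tendsto_sandwich[OF _ _ tendsto_const])
    show "\<forall>\<^sub>F K in sequentially. (norm (y K - ys))\<^sup>2 \<le> 2 * \<sigma> * (\<theta> ^ K * \<Delta>r 0 xs ys)"
    proof (intro always_eventually allI)
      fix K
      have "1 / \<sigma> * breg \<phi>Y ys (y K) \<le> \<theta> ^ K * \<Delta>r 0 xs ys"
        using \<Delta>_lower1[OF xs] decay order_trans by blast
      then have "breg \<phi>Y ys (y K) \<le> \<sigma> * (\<theta> ^ K * \<Delta>r 0 xs ys)" using \<sigma> by (simp add: divide_le_eq mult.commute)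
      then show "(norm (y K - ys))\<^sup>2 \<le> 2 * \<sigma> * (\<theta> ^ K * \<Delta>r 0 xs ys)"
        using bregY(2)[OF ys y_dom, of K] by (simp add: norm_minus_commute)
    qed
    show "(\<lambda>K. 2 * \<sigma> * (\<theta> ^ K * \<Delta>r 0 xs ys)) \<longlonglongrightarrow> 0"
      using tendsto_mult_left[OF \<Delta>_lim, of "2 * \<sigma>"] by simp
  qed auto
  then have y_lim: "y \<longlonglongrightarrow> ys"
    by (simp add: tendsto_norm_zero_iff LIM_zero_iff)

  \<comment> \<open>The case \<open>k = 2\<close>. The shifted index makes \<open>previous y\<close>
    unfold to \<open>y K\<close>, and the increment vanishes by \<open>y_lim\<close>.\<close>
  have "(\<lambda>K. (norm (x (Suc K) - xs))\<^sup>2) \<longlonglongrightarrow> 0"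
  proof (rule tendsto_sandwich[OF _ _ tendsto_const])
    let ?B = "\<lambda>K. 4 * \<tau> * (\<theta> ^ Suc K * \<Delta>r 0 xs ys + \<theta> / \<sigma> * (norm (y (Suc K) - y K))\<^sup>2 / 2)"
    show "\<forall>\<^sub>F K in sequentially. (norm (x (Suc K) - xs))\<^sup>2 \<le> ?B K"
    proof (intro always_eventually allI)
      fix K
      have "0 \<le> 1 / \<sigma> * breg \<phi>Y ys (y (Suc K))"
        using order_trans[OF _ bregY(2)[OF ys y_dom, of "Suc K"], of 0] \<sigma> by simp
      then have "1 / \<tau> * (norm (xs - x (Suc K)))\<^sup>2 / 4
          \<le> \<theta> ^ Suc K * \<Delta>r 0 xs ys + \<theta> / \<sigma> * (norm (y (Suc K) - y K))\<^sup>2 / 2"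
        using \<Delta>_lower[OF xs, of 2 ys "Suc K"] decay[of "Suc K"] by simp
      then show "(norm (x (Suc K) - xs))\<^sup>2 \<le> ?B K"
        using \<tau> by (simp add: norm_minus_commute pos_divide_le_eq ac_simps)
    qed
    have "(\<lambda>K. y (Suc K) - y K) \<longlonglongrightarrow> ys - ys"
      by (intro tendsto_diff LIMSEQ_Suc y_lim)
    then have d: "(\<lambda>K. norm (y (Suc K) - y K)) \<longlonglongrightarrow> 0"
      by (simp add: tendsto_norm_zero)
    have "?B \<longlonglongrightarrow> 4 * \<tau> * (0 + \<theta> / \<sigma> * 0\<^sup>2 / 2)"
      by (intro tendsto_intros LIMSEQ_Suc[OF \<Delta>_lim] d) simp
    then show "?B \<longlonglongrightarrow> 0" by simp
  qed auto
  then have "(\<lambda>K. x (Suc K)) \<longlonglongrightarrow> xs"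
    by (simp add: tendsto_norm_zero_iff LIM_zero_iff)
  then have x_lim: "x \<longlonglongrightarrow> xs" by (simp only: filterlim_sequentially_Suc)

  \<comment> \<open>Ergodic averages\<close>
  have T_pos: "T K > 0" if "K \<ge> 1" for K
    unfolding T using \<theta>(1) that by (intro sum_pos) auto
  \<comment> \<open>Membership of the averages in the domains is included because the return to
    \<open>\<L>\<close> through \<open>L_eq\<close> needs it.\<close>
  have ergodic: "T K * (Lr (X K) v - Lr u (Y K)) \<le> \<Delta>r 0 u v - 1 / \<theta> ^ K * \<Delta>r K u v
      \<and> X K \<in> effdom g \<and> Y K \<in> effdom ?h"
    if u: "u \<in> effdom g" and v: "v \<in> effdom ?h" and K: "K \<ge> 1" for u v K
  proof -
    let ?w = "\<lambda>k. 1 / \<theta> ^ (k - 1)"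
    have T_sum: "T K = sum ?w {1..K}" by (simp add: T)
    have avg_g: "X K \<in> effdom g" "T K * fin g (X K) \<le> (\<Sum>k=1..K. ?w k * fin g (x k))"
      using convex_on_weighted_average[OF g_conv, of "{1..K}" ?w x] K x_dom \<theta>(1) by (auto simp: X T_sum)
    have avg_h: "Y K \<in> effdom ?h" "T K * fin ?h (Y K) \<le> (\<Sum>k=1..K. ?w k * fin ?h (y k))"
      using convex_on_weighted_average[OF h_conv, of "{1..K}" ?w y] K y_dom \<theta>(1) by (auto simp: Y T_sum)
    have "T K *\<^sub>R X K = (\<Sum>k=1..K. ?w k *\<^sub>R x k)" "T K *\<^sub>R Y K = (\<Sum>k=1..K. ?w k *\<^sub>R y k)"
      using T_pos[OF K] by (simp_all add: X Y)
    then have "v (A (T K *\<^sub>R X K)) = v (A (\<Sum>k=1..K. ?w k *\<^sub>R x k))"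
      "(T K *\<^sub>R Y K) (A u) = (\<Sum>k=1..K. ?w k *\<^sub>R y k) (A u)" by (simp_all only:)
    then have lin: "T K * v (A (X K)) = (\<Sum>k=1..K. ?w k * v (A (x k)))"
      "T K * Y K (A u) = (\<Sum>k=1..K. ?w k * y k (A u))"
      by (simp_all only: blinfun.sum_right blinfun.sum_left blinfun.scaleR_right blinfun.scaleR_left real_scaleR_def)
    have const: "T K * a = (\<Sum>k=1..K. ?w k * a)" for a
      by (simp only: T_sum sum_distrib_right)
    have "T K * (Lr (X K) v - Lr u (Y K)) = T K * fin g (X K) + T K * v (A (X K)) - T K * fin ?h v
        - T K * fin g u - T K * Y K (A u) + T K * fin ?h (Y K)"
      by (simp add: Lr_def algebra_simps)
    also have "\<dots> \<le> (\<Sum>k=1..K. ?w k * fin g (x k)) + (\<Sum>k=1..K. ?w k * v (A (x k))) - (\<Sum>k=1..K. ?w k * fin ?h v)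
        - (\<Sum>k=1..K. ?w k * fin g u) - (\<Sum>k=1..K. ?w k * y k (A u)) + (\<Sum>k=1..K. ?w k * fin ?h (y k))"
      using avg_g(2) avg_h(2) unfolding lin const[of "fin ?h v"] const[of "fin g u"] by linarith
    also have "\<dots> = (\<Sum>k=1..K. ?w k * (Lr (x k) v - Lr u (y k)))"
      by (simp add: Lr_def sum.distrib sum_subtractf ring_distribs)
    \<comment> \<open>Multiplied by its weight, the descent inequality telescopes; the induction
      starts from the empty sum, where both sides are 0.\<close>
    also have "\<dots> \<le> \<Delta>r 0 u v - 1 / \<theta> ^ K * \<Delta>r K u v"
    proof (induction K)
      case (Suc K)
      have "?w (Suc K) * (Lr (x (Suc K)) v - Lr u (y (Suc K))) \<le> ?w (Suc K) * (\<Delta>r K u v - \<Delta>r (Suc K) u v / \<theta>)"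
        using descent[OF u v, of K] \<theta>(1) by (intro mult_left_mono) auto
      also have "\<dots> = 1 / \<theta> ^ K * \<Delta>r K u v - 1 / \<theta> ^ Suc K * \<Delta>r (Suc K) u v"
        by (simp add: right_diff_distrib diff_divide_distrib mult.commute)
      finally show ?case using Suc by simp
    qed simp
    finally show ?thesis using avg_g(1) avg_h(1) by simp
  qed

  have XY_lim: "X \<longlonglongrightarrow> xs" "Y \<longlonglongrightarrow> ys"
    using geometric_average_tendsto[OF \<theta>(1,2) x_lim] geometric_average_tendsto[OF \<theta>(1,2) y_lim]
    by (simp_all add: X Y T)

  show ?thesis
  proof (intro conjI allI ballI impI)
    show "T K = (1 - \<theta> ^ K) / ((1 - \<theta>) * \<theta> ^ (K - 1))" if "K \<ge> 1" for K
      unfolding T by (rule geometric_weights_sum[OF \<theta>(1,2) that])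
    show "\<L> (x (Suc k)) v - \<L> u (y (Suc k)) \<le> \<Delta> k u v - \<Delta> (Suc k) u v / ereal \<theta>"
      if "u \<in> effdom g" "v \<in> effdom ?h" for u v k
      using descent[OF that, of k] that x_dom y_dom \<theta>(1) by (simp add: L_eq \<Delta>_eq)
    show "ereal (T K) * (\<L> (X K) v - \<L> u (Y K)) \<le> \<Delta> 0 u v - ereal (1 / \<theta> ^ K) * \<Delta> K u v"
      if "u \<in> effdom g" "v \<in> effdom ?h" "K \<ge> 1" for u v K
      using ergodic[OF that] that by (simp add: L_eq \<Delta>_eq)
    show "ereal (1 / \<sigma>) * bregman \<phi>Y ys (y K) \<le> \<Delta> K xs ys" for K
      using \<Delta>_lower1[OF xs, of ys K] xs ys y_dom by (simp add: \<Delta>_eq bregY(1))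
    show "\<Delta> K xs ys \<le> ereal (\<theta> ^ K) * \<Delta> 0 xs ys" for K
      using decay[of K] xs ys by (simp add: \<Delta>_eq)
    show "(\<lambda>k. (x k, y k)) \<longlonglongrightarrow> (xs, ys)" "(\<lambda>K. (X K, Y K)) \<longlonglongrightarrow> (xs, ys)"
      using x_lim y_lim XY_lim by (auto intro: tendsto_Pair)
  qed
qed

end
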